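(* Let $q\ge 2$ and $d$ be integers with $-q<d\le 0$. Let $M_\ell$ and $N_\ell$ be the number of carries $1$ and $-1$, respectively, when adding two independent random $(q,d)$-expansions of length $\ell$ by standard addition. The expected value of $(M_\ell,N_\ell)$ is $(e_1,e_{-1})\ell+O(1)$ with constants $$e_1=\frac{(q+d-1)^2}{2(q-1)^2},\qquad e_{-1}=\frac{d^2}{2(q-1)^2}.$$ The variance-covariance matrix of $(M_\ell,N_\ell)$ is $\begin{pmatrix}v_1&c\\c&v_{-1}\end{pmatrix}\ell+O(1)$ with constants $$v_1=\frac{(q+d-1)^2\,(q^4-2q^3d-q^2d^2-4qd^2-2q^2-d^2+2d+1)}{4(q-1)^5(q+1)},$$ $$v_{-1}=\frac{d^2\,(2q^4-q^2d^2-4q^3-6q^2d-4qd^2+4q^2+6qd-d^2-4q+2)}{4(q-1)^5(q+1)},$$ $$c=-\frac{d(q+d-1)\,(q^3d+q^2d^2-q^3+3q^2d+4qd^2+2q^2-3qd+d^2-q-d)}{4(q-1)^5(q+1)}.$$ Furthermore, the numbers of carries $1$ and $-1$ are asymptotically jointly normally distributed for $d\neq 0,\,-q+1$. For $d=0$, $M_\ell$ is asymptotically normally distributed and $N_\ell=0$ because the carry $-1$ does not occur. For $d=-q+1$, the same holds with $M_\ell$ and $N_\ell$ exchanged.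
   Context: A $(q,d)$-expansion of length $\ell$ is a word $x_{\ell-1}\ldots x_0$ with digits in $D=\{d,\ldots,q+d-1\}$ (leading zeros allowed), representing $\sum_i x_iq^i$. The probabilistic model is: the two summands $x$ and $y$ are independent, each uniformly distributed on all $q^\ell$ words of length $\ell$ over $D$. Standard addition: put $s_j=x_j+y_j$ for $0\le j<\ell$ and $c_0=0$. For $j=0,\ldots,\ell-1$ let $a=s_j+c_j$ and set $c_{j+1}=1$ if $a\ge q+d$, $c_{j+1}=-1$ if $a\le d-1$, and $c_{j+1}=0$ otherwise; the output digit is $z_j=a-qc_{j+1}\in D$. The carries are $c_1,\ldots,c_\ell$; $M_\ell$ and $N_\ell$ are the numbers of indices $j\in\{1,\ldots,\ell\}$ with $c_j=1$ and $c_j=-1$, respectively. The integers $q,d$ are fixed and asymptotics are for $\ell\to\infty$. A random variable (or vector) is asymptotically (jointly) normally distributed if, after centering by its mean and dividing by $\sqrt{\ell}$, it converges in distribution to a nondegenerate (multivariate) normal law. *)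

theory Defs
  imports "HOL-Probability.Probability"
begin

section \<open>Random expansions and standard addition\<close>

text \<open>The word \<open>x\<^bsub>l-1\<^esub> \<dots> x\<^sub>0\<close> is the function \<open>j \<mapsto> x\<^sub>j\<close> on \<open>{..<l}\<close>;
  so position \<open>0\<close> holds the least significant digit.\<close>

definition expansions :: "int \<Rightarrow> int \<Rightarrow> nat \<Rightarrow> (nat \<Rightarrow> int) set" where
  "expansions q d l = {..<l} \<rightarrow>\<^sub>E {d..q + d - 1}"

definition random_summands :: "int \<Rightarrow> int \<Rightarrow> nat \<Rightarrow> ((nat \<Rightarrow> int) \<times> (nat \<Rightarrow> int)) pmf" where
  "random_summands q d l =
     pair_pmf (pmf_of_set (expansions q d l)) (pmf_of_set (expansions q d l))"

primrec carry :: "int \<Rightarrow> int \<Rightarrow> (nat \<Rightarrow> int) \<Rightarrow> (nat \<Rightarrow> int) \<Rightarrow> nat \<Rightarrow> int" where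
  "carry q d x y 0 = 0"
| "carry q d x y (Suc j) =
     (let a = x j + y j + carry q d x y j
      in if a \<ge> q + d then 1 else if a \<le> d - 1 then - 1 else 0)"

definition num_carries ::
    "int \<Rightarrow> int \<Rightarrow> int \<Rightarrow> nat \<Rightarrow> (nat \<Rightarrow> int) \<times> (nat \<Rightarrow> int) \<Rightarrow> real" where
  "num_carries q d t l = (\<lambda>(x, y). real (card {j \<in> {1..l}. carry q d x y j = t}))"

abbreviation carries_M ::
    "int \<Rightarrow> int \<Rightarrow> nat \<Rightarrow> (nat \<Rightarrow> int) \<times> (nat \<Rightarrow> int) \<Rightarrow> real" where
  "carries_M q d l \<equiv> num_carries q d 1 l"

abbreviation carries_N ::
    "int \<Rightarrow> int \<Rightarrow> nat \<Rightarrow> (nat \<Rightarrow> int) \<times> (nat \<Rightarrow> int) \<Rightarrow> real" where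
  "carries_N q d l \<equiv> num_carries q d (- 1) l"


section \<open>Covariance and asymptotic normality\<close>

definition covariance :: "'a measure \<Rightarrow> ('a \<Rightarrow> real) \<Rightarrow> ('a \<Rightarrow> real) \<Rightarrow> real" where
  "covariance P X Y =
     (\<integral>\<omega>. (X \<omega> - (\<integral>\<omega>'. X \<omega>' \<partial>P)) * (Y \<omega> - (\<integral>\<omega>'. Y \<omega>' \<partial>P)) \<partial>P)"

definition asymptotically_normal :: "(nat \<Rightarrow> 'a measure) \<Rightarrow> (nat \<Rightarrow> 'a \<Rightarrow> real) \<Rightarrow> bool" where
  "asymptotically_normal P X \<longleftrightarrow>
     (\<exists>\<mu> \<sigma>. \<sigma> > 0 \<and>
        weak_conv_m
          (\<lambda>n. distr (P n) borel (\<lambda>\<omega>. (X n \<omega> - (\<integral>\<omega>'. X n \<omega>' \<partial>P n)) / sqrt (real n)))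
          (density lborel (\<lambda>x. ennreal (normal_density \<mu> \<sigma> x))))"

text \<open>The library's \<^const>\<open>weak_conv_m\<close> is defined through distribution functions and only
  covers measures on the real line. In higher dimensions we test against bounded continuous
  functions.\<close>

definition converges_weakly ::
    "(nat \<Rightarrow> 'a::euclidean_space measure) \<Rightarrow> 'a measure \<Rightarrow> bool" where
  "converges_weakly P Q \<longleftrightarrow>
     (\<forall>f :: 'a \<Rightarrow> real. continuous_on UNIV f \<and> bounded (range f) \<longrightarrow>
        (\<lambda>n. \<integral>x. f x \<partial>P n) \<longlonglongrightarrow> (\<integral>x. f x \<partial>Q))"

definition positive_definite :: "real^'n^'n \<Rightarrow> bool" where
  "positive_definite S \<longleftrightarrow> transpose S = S \<and> (\<forall>x. x \<noteq> 0 \<longrightarrow> x \<bullet> (S *v x) > 0)"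

definition multivariate_normal_density ::
    "real^'n \<Rightarrow> real^'n^'n \<Rightarrow> real^'n \<Rightarrow> real" where
  "multivariate_normal_density m S x =
     exp (- ((x - m) \<bullet> (matrix_inv S *v (x - m))) / 2) / sqrt ((2 * pi) ^ CARD('n) * det S)"

definition asymptotically_jointly_normal ::
    "(nat \<Rightarrow> 'a measure) \<Rightarrow> (nat \<Rightarrow> 'a \<Rightarrow> real^'n) \<Rightarrow> bool" where
  "asymptotically_jointly_normal P X \<longleftrightarrow>
     (\<exists>m S. positive_definite S \<and>
        converges_weakly
          (\<lambda>n. distr (P n) borel (\<lambda>\<omega>. (X n \<omega> - (\<integral>\<omega>'. X n \<omega>' \<partial>P n)) /\<^sub>R sqrt (real n)))
          (density lborel (\<lambda>x. ennreal (multivariate_normal_density m S x))))"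

end

theory Submission
  imports Defs
begin

text \<open>
  The carries form a Markov chain on \<open>{-1, 0, 1}\<close> whose transfer operator is triangular in the
  basis \<open>1, c, c\<^sup>2\<close>, so that Poisson equations can be solved explicitly. Let \<open>f\<close> be a centred
  function of the carry, \<open>S\<^sub>l\<close> its sum over the first \<open>l\<close> carries, and \<open>g\<close> the solution of the
  Poisson equation for \<open>f\<close>. Then \<open>S\<^sub>l + g(c\<^sub>l)\<close> is a martingale, which gives the mean; solving the
  Poisson equation for \<open>f\<^sup>2 + 2 f g\<close> by \<open>w\<close> makes \<open>S\<^sub>l\<^sup>2 + 2 S\<^sub>l g(c\<^sub>l) + w(c\<^sub>l) - l v\<close> a martingale,
  where \<open>v\<close> is the stationary mean of \<open>f\<^sup>2 + 2 f g\<close>, which gives the variance. Finally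
  \<open>1 + i \<theta> g - \<theta>\<^sup>2 w / 2\<close> is, up to an error \<open>O(\<theta>\<^sup>3)\<close>, an eigenfunction of the transfer operator
  twisted by \<open>exp(i \<theta> f)\<close> for the eigenvalue \<open>exp(- \<theta>\<^sup>2 v / 2)\<close>. Iterating \<open>l\<close> times with
  \<open>\<theta> = 1 / \<surd>l\<close> gives the limit of the characteristic function. Applying this to all linear
  combinations of the indicators of the carries \<open>1\<close> and \<open>-1\<close> yields the joint statement.
\<close>

section \<open>Weak convergence from characteristic functions\<close>

text \<open>The chain is tractable because of a count: the digit pairs that produce a given carry
  form a triangle at a corner of the square of all digit pairs, so the transition probabilities are
  quadratic polynomials in the incoming carry. The corrector g is bounded and costs O(1) in the
  mean, but the cross term S_l g(c_l) is a priori only of order sqrt l. An O(1) remainder in the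
  variance requires the expectations of S_l c_l and S_l c_l^2 to stay bounded; the eigenvalues 1/q
  and 1/q^2 give this through contracting recursions. In the limit law each of the l steps has an
  error of order l^(-3/2), so the total error is of order l^(-1/2). Joint normality is tested on
  bounded continuous functions of the plane, so characteristic functions have to be turned into weak
  convergence in a Euclidean space. Tightness is read off the linear growth of the variances. The
  limit is nondegenerate exactly when the determinant of the covariance constants is positive; it
  vanishes for d = 0 and d = -q + 1, where one kind of carry disappears.\<close>

inductive trig_poly :: "('a::euclidean_space \<Rightarrow> complex) \<Rightarrow> bool" where
  cis: "trig_poly (\<lambda>x. cis (t \<bullet> x))"
| scale: "trig_poly f \<Longrightarrow> trig_poly (\<lambda>x. c * f x)"
| add: "trig_poly f \<Longrightarrow> trig_poly g \<Longrightarrow> trig_poly (\<lambda>x. f x + g x)"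

lemma trig_poly_mult_cis:
  assumes "trig_poly g"
  shows "trig_poly (\<lambda>x. cis (t \<bullet> x) * g x)"
  using assms
proof induction
  case (cis s)
  then show ?case
    using trig_poly.cis[of "t + s"] by (simp add: cis_mult inner_add_left)
next
  case (scale f c)
  then show ?case using trig_poly.scale[OF scale.IH, of c] by (simp add: mult_ac)
next
  case (add f g)
  then show ?case using trig_poly.add[OF add.IH] by (simp add: algebra_simps)
qed

text \<open>Since \<open>cis\<close> turns sums into products, the span of the characters is an
  algebra. Products are needed because polynomials in sines and cosines of the coordinates enter
  below.\<close>

lemma trig_poly_mult:
  assumes "trig_poly f" "trig_poly g"
  shows "trig_poly (\<lambda>x. f x * g x)"
  using assms
proof induction
  case (cis s)
  then show ?case by (rule trig_poly_mult_cis)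
next
  case (scale f c)
  then show ?case using trig_poly.scale[of "\<lambda>x. f x * g x" c] by (simp add: mult_ac)
next
  case (add f g)
  then show ?case using trig_poly.add by (fastforce simp: algebra_simps)
qed

lemma trig_poly_const: "trig_poly (\<lambda>x. c)"
  using trig_poly.scale[OF trig_poly.cis[of 0], of c] by simp

lemma trig_poly_sum:
  assumes "finite A" "\<And>b. b \<in> A \<Longrightarrow> trig_poly (f b)"
  shows "trig_poly (\<lambda>x. \<Sum>b\<in>A. f b x)"
  using assms by (induction A rule: finite_induct) (auto intro: trig_poly_const trig_poly.add)

lemma trig_poly_cos: "trig_poly (\<lambda>x. complex_of_real (cos (t \<bullet> x)))"
proof -
  have "complex_of_real (cos u) = 1/2 * cis u + 1/2 * cis (- u)" for u
    by (simp add: complex_eq_iff)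
  then show ?thesis
    using trig_poly.add[OF trig_poly.scale[OF trig_poly.cis[of t], of "1/2"]
        trig_poly.scale[OF trig_poly.cis[of "- t"], of "1/2"]] by simp
qed

lemma trig_poly_sin: "trig_poly (\<lambda>x. complex_of_real (sin (t \<bullet> x)))"
proof -
  have "complex_of_real (sin u) = (- \<i>/2) * cis u + \<i>/2 * cis (- u)" for u
    by (simp add: complex_eq_iff)
  then show ?thesis
    using trig_poly.add[OF trig_poly.scale[OF trig_poly.cis[of t], of "- \<i>/2"]
        trig_poly.scale[OF trig_poly.cis[of "- t"], of "\<i>/2"]] by simp
qed

lemma trig_poly_bounded_continuous:
  assumes "trig_poly f"
  shows "continuous_on UNIV f \<and> (\<exists>B. \<forall>x. norm (f x) \<le> B)"
  using assms
proof induction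
  case (cis t)
  then show ?case by (auto intro!: continuous_intros exI[of _ 1])
next
  case (scale f c)
  then obtain B where "\<forall>x. norm (f x) \<le> B" by blast
  then have "\<forall>x. norm (c * f x) \<le> norm c * B" by (simp add: norm_mult mult_left_mono)
  with scale show ?case by (auto intro!: continuous_intros)
next
  case (add f g)
  then obtain B C where "\<forall>x. norm (f x) \<le> B" "\<forall>x. norm (g x) \<le> C" by blast
  then have "\<forall>x. norm (f x + g x) \<le> B + C" by (meson add_mono norm_triangle_le)
  with add show ?case by (auto intro!: continuous_intros)
qed

lemma integrable_bounded_continuous:
  fixes f :: "'a::topological_space \<Rightarrow> 'c::{banach, second_countable_topology}"
  assumes "prob_space M" "sets M = sets borel" "continuous_on UNIV f" "\<And>x. norm (f x) \<le> B"
  shows "integrable M f"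
proof -
  interpret prob_space M by fact
  have "f \<in> borel_measurable M"
    using borel_measurable_continuous_onI[OF assms(3)] assms(2)
    by (simp cong: measurable_cong_sets)
  then show ?thesis by (intro integrable_const_bound[where B = B]) (simp_all add: assms(4))
qed

lemma trig_poly_integrable:
  assumes "trig_poly f" "prob_space M" "sets M = sets borel"
  shows "integrable M f"
  using trig_poly_bounded_continuous[OF assms(1)] integrable_bounded_continuous[OF assms(2,3)]
  by blast

text \<open>Both integrals are linear in \<open>f\<close>, so convergence of the characteristic
  functions, which is the case of a generator, passes to the whole span.\<close>

lemma trig_poly_integral_tendsto:
  assumes "trig_poly f"
  assumes P: "\<And>n. prob_space (P n)" "\<And>n. sets (P n) = sets borel"
    and Q: "prob_space Q" "sets Q = sets borel"
    and char: "\<And>t. (\<lambda>n. \<integral>x. cis (t \<bullet> x) \<partial>P n) \<longlonglongrightarrow> (\<integral>x. cis (t \<bullet> x) \<partial>Q)"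
  shows "(\<lambda>n. \<integral>x. f x \<partial>P n) \<longlonglongrightarrow> (\<integral>x. f x \<partial>Q)"
  using assms(1)
proof induction
  case (cis t)
  then show ?case by (rule char)
next
  case (scale f c)
  then show ?case by (simp add: tendsto_intros)
next
  case (add f g)
  then show ?case
    by (simp add: trig_poly_integrable P Q tendsto_add)
qed

text \<open>
  \<open>unroll L\<close> wraps the space around a torus, on which trigonometric polynomials are polynomials and
  Stone--Weierstrass applies. A test function \<open>f\<close> is replaced by the periodic function
  \<open>f (reroll L (unroll L x)) * cutoff (unroll L x)\<close>; the cutoff vanishes where \<open>reroll\<close> stops
  being an inverse of \<open>unroll\<close> and tends to \<open>1\<close> locally uniformly as \<open>L \<rightarrow> \<infinity>\<close>.
\<close>

definition unroll :: "real \<Rightarrow> 'a::euclidean_space \<Rightarrow> 'a \<times> 'a" where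
  "unroll L x = (\<Sum>b\<in>Basis. cos (x \<bullet> b / L) *\<^sub>R b, \<Sum>b\<in>Basis. sin (x \<bullet> b / L) *\<^sub>R b)"

text \<open>A linear functional is determined by its values on the basis, so applied to
  \<open>unroll L x\<close> it becomes a combination of single cosines and sines; closure under sums
  and products does the rest.\<close>

lemma trig_poly_unroll:
  assumes "real_polynomial_function p"
  shows "trig_poly (\<lambda>x. complex_of_real (p (unroll L x)))"
  using assms
proof (induction rule: real_polynomial_function.induct)
  case (linear f)
  interpret f: bounded_linear f by fact
  have cos: "trig_poly (\<lambda>x. complex_of_real (cos (x \<bullet> b / L)))" for b :: 'a
    using trig_poly_cos[of "b /\<^sub>R L"] by (simp add: inner_commute field_simps)
  have sin: "trig_poly (\<lambda>x. complex_of_real (sin (x \<bullet> b / L)))" for b :: 'a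
    using trig_poly_sin[of "b /\<^sub>R L"] by (simp add: inner_commute field_simps)
  have "f (unroll L x) = (\<Sum>b\<in>Basis. f (b, 0) * cos (x \<bullet> b / L)) +
      (\<Sum>b\<in>Basis. f (0, b) * sin (x \<bullet> b / L))" for x
  proof -
    have "unroll L x = (\<Sum>b\<in>Basis. cos (x \<bullet> b / L) *\<^sub>R (b, 0)) + (\<Sum>b\<in>Basis. sin (x \<bullet> b / L) *\<^sub>R (0, b))"
      by (simp add: unroll_def prod_eq_iff fst_sum snd_sum)
    then have "f (unroll L x) = (\<Sum>b\<in>Basis. cos (x \<bullet> b / L) *\<^sub>R f (b, 0)) +
        (\<Sum>b\<in>Basis. sin (x \<bullet> b / L) *\<^sub>R f (0, b))"
      by (simp only: f.add f.sum f.scaleR)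
    then show ?thesis by (simp add: mult_ac)
  qed
  then show ?case
    by (auto simp: intro!: trig_poly.add trig_poly_sum trig_poly.scale cos sin)
next
  case (const c)
  then show ?case by (rule trig_poly_const)
next
  case (add f g)
  then show ?case by (simp add: trig_poly.add)
next
  case (mult f g)
  then show ?case by (simp add: trig_poly_mult)
qed


definition reroll :: "real \<Rightarrow> 'a::euclidean_space \<times> 'a \<Rightarrow> 'a" where
  "reroll L z = L *\<^sub>R (\<Sum>b\<in>Basis. arcsin (snd z \<bullet> b) *\<^sub>R b)"

definition cutoff :: "'a::euclidean_space \<times> 'a \<Rightarrow> real" where
  "cutoff z = (\<Prod>b\<in>Basis. max 0 (fst z \<bullet> b))"

lemma unroll_box: "unroll L x \<in> cbox (- (\<Sum>b\<in>Basis. b)) (\<Sum>b\<in>Basis. b) \<times> cbox (- (\<Sum>b\<in>Basis. b)) (\<Sum>b\<in>Basis. b)"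
  by (simp add: unroll_def mem_box inner_minus_left)

lemma reroll_unroll:
  assumes "L > 0" "norm x \<le> L"
  shows "reroll L (unroll L x) = x"
proof -
  have "arcsin (sin (x \<bullet> b / L)) = x \<bullet> b / L" if "b \<in> Basis" for b
  proof (rule arcsin_sin)
    \<comment> \<open>Since 1 < pi / 2, the angle lies on the branch that \<open>arcsin\<close>
      inverts.\<close>
    have "\<bar>x \<bullet> b / L\<bar> \<le> 1"
      using assms Basis_le_norm[OF that, of x] by (simp add: field_simps)
    then show "- (pi / 2) \<le> x \<bullet> b / L" "x \<bullet> b / L \<le> pi / 2"
      using pi_gt3 by linarith+
  qed
  then have "reroll L (unroll L x) = L *\<^sub>R (\<Sum>b\<in>Basis. (x \<bullet> b / L) *\<^sub>R b)"
    by (simp add: reroll_def unroll_def)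
  also have "\<dots> = (\<Sum>b\<in>Basis. (x \<bullet> b) *\<^sub>R b)"
    using assms by (simp add: scaleR_sum_right)
  finally show ?thesis by (simp add: euclidean_representation)
qed

lemma cutoff_nonneg: "0 \<le> cutoff z"
  by (simp add: cutoff_def prod_nonneg)

lemma cutoff_unroll_le_1: "cutoff (unroll L x) \<le> 1"
  by (auto simp: cutoff_def unroll_def intro!: prod_le_1)

text \<open>On the ball every angle is at most \<open>R / L \<le> 1\<close> in modulus, where the
  cosine is positive and decreasing, so each factor of the product is at least
  \<open>cos (R / L)\<close>.\<close>

lemma cutoff_unroll_ge:
  fixes x :: "'a::euclidean_space"
  assumes "L > 0" "norm x \<le> R" "R \<le> L"
  shows "cutoff (unroll L x) \<ge> cos (R / L) ^ DIM('a)"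
proof -
  have R: "0 \<le> R" using assms(2) norm_ge_zero order_trans by blast
  then have RL: "0 \<le> R / L" "R / L \<le> 1" using assms by auto
  have "(\<Prod>b\<in>(Basis :: 'a set). cos (R / L)) \<le> (\<Prod>b\<in>Basis. max 0 (cos (x \<bullet> b / L)))"
  proof (intro prod_mono conjI)
    fix b :: 'a assume "b \<in> Basis"
    show "0 \<le> cos (R / L)" using RL pi_gt3 by (intro cos_ge_zero) linarith+
    have "\<bar>x \<bullet> b / L\<bar> \<le> R / L"
      using assms Basis_le_norm[OF \<open>b \<in> Basis\<close>, of x] by (simp add: divide_right_mono)
    moreover have "cos (R / L) \<le> cos \<bar>x \<bullet> b / L\<bar>"
      using calculation RL pi_gt3 by (intro cos_monotone_0_pi_le) auto
    ultimately show "cos (R / L) \<le> max 0 (cos (x \<bullet> b / L))"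
      by (metis cos_abs_real max.coboundedI2)
  qed
  then show ?thesis by (simp add: cutoff_def unroll_def)
qed

text \<open>Stone--Weierstrass is applied on a whole cube containing the torus;
  \<open>arcsin\<close> is continuous on [-1, 1], so the approximated function is continuous there.
  As \<open>unroll\<close> takes all its values in the cube, the error is uniform over the entire
  space.\<close>

lemma trig_poly_approx:
  fixes f :: "'a::euclidean_space \<Rightarrow> real"
  assumes f: "continuous_on UNIV f" and "e > 0"
  obtains g where "trig_poly (\<lambda>x. complex_of_real (g x))"
    "\<And>x. \<bar>f (reroll L (unroll L x)) * cutoff (unroll L x) - g x\<bar> < e"
proof -
  let ?K = "cbox (- (\<Sum>b\<in>Basis. b)) (\<Sum>b\<in>Basis. b) :: 'a set"
  have "compact (?K \<times> ?K)" by (intro compact_Times compact_cbox)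
  moreover have "continuous_on (?K \<times> ?K) (\<lambda>z. f (reroll L z) * cutoff z)"
  proof (intro continuous_on_mult)
    have "continuous_on (?K \<times> ?K) (reroll L)"
      unfolding reroll_def
      by (intro continuous_intros) (auto simp: mem_box inner_minus_left)
    then show "continuous_on (?K \<times> ?K) (\<lambda>z. f (reroll L z))"
      by (rule continuous_on_compose2[OF f]) simp
    show "continuous_on (?K \<times> ?K) cutoff"
      unfolding cutoff_def by (intro continuous_intros)
  qed
  ultimately obtain p where p: "real_polynomial_function p"
    "\<And>z. z \<in> ?K \<times> ?K \<Longrightarrow> \<bar>f (reroll L z) * cutoff z - p z\<bar> < e"
    using Stone_Weierstrass_real_polynomial_function[OF _ _ \<open>e > 0\<close>] by blast
  show ?thesis
    using that[of "\<lambda>x. p (unroll L x)"] trig_poly_unroll[OF p(1)] p(2)[OF unroll_box] by blast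
qed

text \<open>On a fixed ball rerolling is exact once \<open>L > R\<close>, so the only error is
  \<open>\<bar>f x\<bar>\<close> times the defect of the cutoff from 1, and
  \<open>cos (R / L)\<close> tends to 1. Dividing by \<open>B + 1\<close> covers
  \<open>B = 0\<close>.\<close>

lemma unroll_eventually:
  fixes f :: "'a::euclidean_space \<Rightarrow> real"
  assumes "e > 0" and B: "\<And>x. \<bar>f x\<bar> \<le> B"
  shows "\<forall>\<^sub>F L in at_top. \<forall>x. norm x \<le> R \<longrightarrow> \<bar>f (reroll L (unroll L x)) * cutoff (unroll L x) - f x\<bar> < e"
proof -
  have B0: "0 \<le> B" using B[of 0] by linarith
  have "((\<lambda>L. cos (R / L) ^ DIM('a)) \<longlongrightarrow> cos 0 ^ DIM('a)) at_top"
    by (intro tendsto_intros tendsto_divide_0[OF tendsto_const] filterlim_at_top_imp_at_infinity filterlim_ident)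
  then have "\<forall>\<^sub>F L in at_top. cos (R / L) ^ DIM('a) > 1 - e / (B + 1)"
    using assms(1) B0 by (intro order_tendstoD(1)) auto
  moreover have "\<forall>\<^sub>F L in at_top. L > max 0 R" by (rule eventually_gt_at_top)
  ultimately show ?thesis
  proof eventually_elim
    case (elim L)
    show ?case
    proof (intro allI impI)
      fix x :: 'a assume "norm x \<le> R"
      with elim have "cutoff (unroll L x) > 1 - e / (B + 1)" "reroll L (unroll L x) = x"
        using cutoff_unroll_ge[of L x R] by (auto intro!: reroll_unroll)
      moreover have "\<bar>f x\<bar> * (1 - cutoff (unroll L x)) \<le> B * (1 - cutoff (unroll L x))"
        using B cutoff_unroll_le_1 by (intro mult_right_mono) auto
      moreover have "B * (1 - cutoff (unroll L x)) \<le> B * (e / (B + 1))"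
        using calculation(1) B0 by (intro mult_left_mono) auto
      moreover have "B * (e / (B + 1)) < e" using B0 assms(1) by (simp add: field_simps)
      moreover have "\<bar>f x * cutoff (unroll L x) - f x\<bar> = \<bar>f x\<bar> * (1 - cutoff (unroll L x))"
        using cutoff_unroll_le_1[of L x]
        by (metis abs_minus_commute abs_mult abs_of_nonneg diff_ge_0_iff_ge mult.right_neutral right_diff_distrib)
      ultimately show "\<bar>f (reroll L (unroll L x)) * cutoff (unroll L x) - f x\<bar> < e"
        by simp
    qed
  qed
qed

text \<open>For fixed \<open>L\<close> the trigonometric approximation is uniform in space, which
  gives convergence of the integrals of \<open>h L\<close>. The passage from \<open>h L\<close> to
  \<open>f\<close> is controlled on a ball by \<open>unroll_eventually\<close> and outside it by a
  Chebyshev bound that is uniform in \<open>n\<close>; for the single measure \<open>Q\<close>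
  dominated convergence suffices.\<close>

theorem converges_weakly_char:
  fixes P :: "nat \<Rightarrow> 'a::euclidean_space measure"
  assumes P: "\<And>n. prob_space (P n)" "\<And>n. sets (P n) = sets borel"
    and Q: "prob_space Q" "sets Q = sets borel"
    and char: "\<And>t. (\<lambda>n. \<integral>x. cis (t \<bullet> x) \<partial>P n) \<longlonglongrightarrow> (\<integral>x. cis (t \<bullet> x) \<partial>Q)"
    and moment: "\<And>n. integrable (P n) (\<lambda>x. (norm x)\<^sup>2)" "\<And>n. (\<integral>x. (norm x)\<^sup>2 \<partial>P n) \<le> K"
  shows "converges_weakly P Q"
  unfolding converges_weakly_def
proof (intro allI impI, elim conjE)
  fix f :: "'a \<Rightarrow> real"
  assume f: "continuous_on UNIV f" and "bounded (range f)"
  then obtain B where B: "\<And>x. \<bar>f x\<bar> \<le> B" by (auto simp: bounded_iff)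
  have B0: "0 \<le> B" using B[of 0] by linarith
  have K0: "0 \<le> K" using moment(2)[of 0] by (rule order_trans[rotated]) simp
  define h where "h L x = f (reroll L (unroll L x)) * cutoff (unroll L x)" for L x
  have hB: "\<bar>h L x\<bar> \<le> B" for L x
    using mult_mono[OF B cutoff_unroll_le_1 B0 cutoff_nonneg]
    by (simp add: h_def abs_mult cutoff_nonneg)
  have cint: "integrable M f" if "prob_space M" "sets M = sets borel" for M
    using integrable_bounded_continuous[OF that f, where B = B] B by simp
  have h_cont: "continuous_on UNIV (h L)" for L
  proof -
    \<comment> \<open>For \<open>L = 0\<close> division by zero makes \<open>unroll\<close>
      constant.\<close>
    have 1: "continuous_on UNIV (\<lambda>x :: 'a. reroll L (unroll L x))"
      unfolding unroll_def reroll_def by (cases "L = 0") (auto intro!: continuous_intros)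
    have 2: "continuous_on UNIV (\<lambda>x :: 'a. cutoff (unroll L x))"
      unfolding unroll_def cutoff_def by (cases "L = 0") (auto intro!: continuous_intros)
    show ?thesis unfolding h_def
      by (intro continuous_on_mult 2 continuous_on_compose2[OF f 1]) simp
  qed
  have hint: "integrable M (h L)" if "prob_space M" "sets M = sets borel" for M L
    using integrable_bounded_continuous[OF that h_cont, where B = B] hB by simp
  have h_lim: "(\<lambda>n. \<integral>x. h L x \<partial>P n) \<longlonglongrightarrow> (\<integral>x. h L x \<partial>Q)" for L
  proof (rule LIMSEQ_I)
    fix e :: real assume "e > 0"
    then obtain g where g: "trig_poly (\<lambda>x. complex_of_real (g x))" "\<And>x. \<bar>h L x - g x\<bar> < e / 4"
      using trig_poly_approx[OF f, of "e / 4" L] unfolding h_def by auto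
    have gint: "integrable M g" if "prob_space M" "sets M = sets borel" for M
      using trig_poly_integrable[OF g(1) that] by (simp add: complex_of_real_integrable_eq)
    have close: "\<bar>(\<integral>x. h L x \<partial>M) - (\<integral>x. g x \<partial>M)\<bar> \<le> e / 4"
      if "prob_space M" "sets M = sets borel" for M
    proof -
      interpret prob_space M by fact
      have "\<bar>\<integral>x. h L x - g x \<partial>M\<bar> \<le> (\<integral>x. e / 4 \<partial>M)"
        using g(2) by (intro integral_abs_bound_integral)
            (auto intro!: hint gint that Bochner_Integration.integrable_diff less_imp_le)
      then show ?thesis by (simp add: hint gint that prob_space)
    qed
    have "(\<lambda>n. \<integral>x. complex_of_real (g x) \<partial>P n) \<longlonglongrightarrow> (\<integral>x. complex_of_real (g x) \<partial>Q)"
      by (rule trig_poly_integral_tendsto[OF g(1) P Q char])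
    then have "(\<lambda>n. \<integral>x. g x \<partial>P n) \<longlonglongrightarrow> (\<integral>x. g x \<partial>Q)"
      by (simp add: tendsto_of_real_iff)
    from LIMSEQ_D[OF this, of "e / 4"] \<open>e > 0\<close>
    obtain N where N: "\<And>n. n \<ge> N \<Longrightarrow> \<bar>(\<integral>x. g x \<partial>P n) - (\<integral>x. g x \<partial>Q)\<bar> < e / 4" by auto
    have comb: "\<bar>a - b\<bar> < e" if "\<bar>a - a'\<bar> \<le> e / 4" "\<bar>b - b'\<bar> \<le> e / 4" "\<bar>a' - b'\<bar> < e / 4" for a b a' b' :: real
      using that \<open>e > 0\<close> by linarith
    show "\<exists>N. \<forall>n\<ge>N. norm ((\<integral>x. h L x \<partial>P n) - (\<integral>x. h L x \<partial>Q)) < e"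
      unfolding real_norm_def using comb[OF close[OF P] close[OF Q] N] by (intro exI allI impI)
  qed
  have h_Q: "((\<lambda>L. \<integral>x. h L x \<partial>Q) \<longlongrightarrow> (\<integral>x. f x \<partial>Q)) at_top"
  proof (rule integral_dominated_convergence_at_top[where w = "\<lambda>_. B"])
    show "integrable Q (\<lambda>_. B)" using Q by (simp add: prob_space.finite_measure finite_measure.integrable_const)
    show "f \<in> borel_measurable Q" "\<And>L. h L \<in> borel_measurable Q"
      using cint hint Q by (auto intro: borel_measurable_integrable)
    show "\<forall>\<^sub>F L in at_top. AE x in Q. norm (h L x) \<le> B" by (simp add: hB)
    show "AE x in Q. ((\<lambda>L. h L x) \<longlongrightarrow> f x) at_top"
    proof (intro AE_I2 tendstoI)
      fix x :: 'a and e :: real assume "e > 0"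
      show "\<forall>\<^sub>F L in at_top. dist (h L x) (f x) < e"
        using unroll_eventually[OF \<open>e > 0\<close> B, of "norm x"]
        by eventually_elim (auto simp: dist_real_def h_def)
    qed
  qed
  show "(\<lambda>n. \<integral>x. f x \<partial>P n) \<longlonglongrightarrow> (\<integral>x. f x \<partial>Q)"
  proof (rule LIMSEQ_I)
    fix e :: real assume "e > 0"
    \<comment> \<open>Outside radius \<open>R\<close> the two functions differ by at most
      \<open>2 * B\<close>, which Chebyshev turns into \<open>2 * B * K / R\<^sup>2\<close>; this
      choice makes it at most \<open>e / 4\<close>. The added 1s keep \<open>R\<close> positive when
      \<open>B\<close> or \<open>K\<close> is 0.\<close>
    define R where "R = sqrt (8 * (B + 1) * (K + 1) / e)"
    have R2: "R\<^sup>2 = 8 * (B + 1) * (K + 1) / e" and R0: "R > 0"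
      using \<open>e > 0\<close> B0 K0 by (auto simp: R_def)
    have "\<forall>\<^sub>F L in at_top. \<bar>(\<integral>x. h L x \<partial>Q) - (\<integral>x. f x \<partial>Q)\<bar> < e / 4"
      using tendstoD[OF h_Q, of "e / 4"] \<open>e > 0\<close> by (simp add: dist_real_def)
    moreover have "\<forall>\<^sub>F L in at_top. \<forall>x. norm x \<le> R \<longrightarrow> \<bar>h L x - f x\<bar> < e / 4"
      unfolding h_def by (rule unroll_eventually[OF _ B]) (use \<open>e > 0\<close> in simp)
    ultimately have "\<forall>\<^sub>F L in at_top. \<bar>(\<integral>x. h L x \<partial>Q) - (\<integral>x. f x \<partial>Q)\<bar> < e / 4 \<and>
        (\<forall>x. norm x \<le> R \<longrightarrow> \<bar>h L x - f x\<bar> < e / 4)"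
      by (rule eventually_conj)
    then obtain L where L: "\<bar>(\<integral>x. h L x \<partial>Q) - (\<integral>x. f x \<partial>Q)\<bar> < e / 4"
      "\<And>x. norm x \<le> R \<Longrightarrow> \<bar>h L x - f x\<bar> < e / 4"
      using eventually_happens'[OF trivial_limit_at_top_linorder] by blast
    have close: "\<bar>(\<integral>x. h L x \<partial>P n) - (\<integral>x. f x \<partial>P n)\<bar> \<le> e / 2" for n
    proof -
      interpret prob_space "P n" by (rule P)
      have pt: "\<bar>h L x - f x\<bar> \<le> e / 4 + 2 * B / R\<^sup>2 * (norm x)\<^sup>2" for x
      proof (cases "norm x \<le> R")
        case True
        have "0 \<le> 2 * B / R\<^sup>2 * (norm x)\<^sup>2" using B0 by simp
        then show ?thesis using L(2)[OF True] by linarith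
      next
        case False
        then have "R\<^sup>2 \<le> (norm x)\<^sup>2" using R0 by (intro power_mono) auto
        then have "2 * B * 1 \<le> 2 * B * ((norm x)\<^sup>2 / R\<^sup>2)"
          using B0 R0 by (intro mult_left_mono) (auto simp: field_simps)
        moreover have "\<bar>h L x - f x\<bar> \<le> 2 * B" using hB[of L x] B[of x] by linarith
        ultimately show ?thesis using \<open>e > 0\<close> by simp
      qed
      have "\<bar>\<integral>x. h L x - f x \<partial>P n\<bar> \<le> (\<integral>x. e / 4 + 2 * B / R\<^sup>2 * (norm x)\<^sup>2 \<partial>P n)"
      proof (rule integral_abs_bound_integral[OF _ _ pt])
        show "integrable (P n) (\<lambda>x. h L x - f x)"
          by (intro Bochner_Integration.integrable_diff hint cint P)
        show "integrable (P n) (\<lambda>x. e / 4 + 2 * B / R\<^sup>2 * (norm x)\<^sup>2)"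
          by (intro Bochner_Integration.integrable_add integrable_mult_right moment(1)) simp
      qed
      also have "\<dots> = e / 4 + 2 * B / R\<^sup>2 * (\<integral>x. (norm x)\<^sup>2 \<partial>P n)"
        using moment(1) by (simp add: prob_space)
      also have "\<dots> \<le> e / 4 + 2 * B / R\<^sup>2 * K"
        using moment(2) B0 by (intro add_left_mono mult_left_mono) auto
      also have "2 * B / R\<^sup>2 * K \<le> e / 4"
      proof -
        define C where "C = (B + 1) * (K + 1)"
        have "B * K \<le> C" using B0 K0 by (simp add: C_def algebra_simps)
        have "C > 0" using B0 K0 by (simp add: C_def)
        have "B * K / C * (e / 4) \<le> 1 * (e / 4)"
          using \<open>e > 0\<close> \<open>C > 0\<close> \<open>B * K \<le> C\<close> by (intro mult_right_mono) (auto simp: divide_le_eq)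
        moreover have "R\<^sup>2 = 8 * C / e" by (simp add: R2 C_def)
        ultimately show ?thesis by (simp add: mult_ac)
      qed
      finally show ?thesis by (simp add: hint cint P)
    qed
    from LIMSEQ_D[OF h_lim, of "e / 4" L] \<open>e > 0\<close>
    obtain N where N: "\<And>n. n \<ge> N \<Longrightarrow> \<bar>(\<integral>x. h L x \<partial>P n) - (\<integral>x. h L x \<partial>Q)\<bar> < e / 4" by auto
    have comb: "\<bar>a - b\<bar> < e" if "\<bar>a' - a\<bar> \<le> e / 2" "\<bar>b' - b\<bar> < e / 4" "\<bar>a' - b'\<bar> < e / 4" for a b a' b' :: real
      using that \<open>e > 0\<close> by linarith
    show "\<exists>N. \<forall>n\<ge>N. norm ((\<integral>x. f x \<partial>P n) - (\<integral>x. f x \<partial>Q)) < e"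
      unfolding real_norm_def using comb[OF close L(1) N] by (intro exI allI impI)
  qed
qed

section \<open>Normal laws as limits\<close>

lemma matrix_inv_eqI:
  fixes A B :: "'a::semiring_1^'n^'n"
  assumes "A ** B = mat 1" "B ** A = mat 1"
  shows "matrix_inv A = B"
proof -
  have "A ** matrix_inv A = mat 1 \<and> matrix_inv A ** A = mat 1"
    unfolding matrix_inv_def by (rule someI[of _ B]) (simp add: assms)
  then show ?thesis
    by (metis assms(1) matrix_mul_assoc matrix_mul_lid matrix_mul_rid)
qed

text \<open>The substitution \<open>\<mu> + \<sigma> * x\<close> reduces this to the standard normal
  law. A general mean is allowed because the second coordinate of a planar normal vector,
  conditioned on the first, is centred at a multiple of the first.\<close>

lemma integral_normal_density_cis:
  assumes "\<sigma> > 0"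
  shows "(\<integral>x. normal_density \<mu> \<sigma> x *\<^sub>R cis (t * x) \<partial>lborel) = cis (t * \<mu>) * exp (- (\<sigma> * t)\<^sup>2 / 2)"
proof -
  have std: "(\<integral>x. std_normal_density x *\<^sub>R cis (s * x) \<partial>lborel) = exp (- s\<^sup>2 / 2)" for s
  proof -
    have "char std_normal_distribution s = (\<integral>x. std_normal_density x *\<^sub>R cis (s * x) \<partial>lborel)"
      unfolding char_def by (subst integral_density) (auto simp: cis_conv_exp)
    then show ?thesis by (simp add: char_std_normal_distribution)
  qed
  have dens: "\<sigma> * normal_density \<mu> \<sigma> (\<mu> + \<sigma> * x) = std_normal_density x" for x
    using assms by (simp add: normal_density_def real_sqrt_mult power_mult_distrib field_simps)
  have "(\<integral>x. normal_density \<mu> \<sigma> x *\<^sub>R cis (t * x) \<partial>lborel)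
      = \<sigma> *\<^sub>R (\<integral>x. normal_density \<mu> \<sigma> (\<mu> + \<sigma> * x) *\<^sub>R cis (t * (\<mu> + \<sigma> * x)) \<partial>lborel)"
    using assms by (subst lborel_integral_real_affine[of \<sigma> _ \<mu>]) auto
  also have "\<dots> = (\<integral>x. \<sigma> *\<^sub>R (normal_density \<mu> \<sigma> (\<mu> + \<sigma> * x) *\<^sub>R cis (t * (\<mu> + \<sigma> * x))) \<partial>lborel)"
    by (rule integral_scaleR_right[symmetric])
  also have "\<dots> = (\<integral>x. cis (t * \<mu>) * (std_normal_density x *\<^sub>R cis (t * \<sigma> * x)) \<partial>lborel)"
  proof (rule Bochner_Integration.integral_cong)
    fix x
    have "\<sigma> *\<^sub>R (normal_density \<mu> \<sigma> (\<mu> + \<sigma> * x) *\<^sub>R cis (t * (\<mu> + \<sigma> * x)))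
        = std_normal_density x *\<^sub>R cis (t * \<mu> + t * \<sigma> * x)"
      by (simp only: scaleR_scaleR dens) (simp add: distrib_left mult.assoc)
    then show "\<sigma> *\<^sub>R (normal_density \<mu> \<sigma> (\<mu> + \<sigma> * x) *\<^sub>R cis (t * (\<mu> + \<sigma> * x)))
        = cis (t * \<mu>) * (std_normal_density x *\<^sub>R cis (t * \<sigma> * x))"
      by (simp add: cis_mult)
  qed simp
  also have "\<dots> = cis (t * \<mu>) * exp (- (t * \<sigma>)\<^sup>2 / 2)"
    by (simp only: integral_mult_right_zero std)
  finally show ?thesis by (simp add: mult_ac)
qed

lemma nn_integral_normal_density:
  assumes "\<sigma> > 0"
  shows "(\<integral>\<^sup>+x. ennreal (normal_density \<mu> \<sigma> x) \<partial>lborel) = 1"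
  by (subst nn_integral_eq_integral) (simp_all add: assms)

lemma vector_2_eq: "(vector [x, y] :: real^2) = x *\<^sub>R axis 1 1 + y *\<^sub>R axis 2 1"
  by (simp add: vec_eq_iff forall_2 axis_def)

lemma vector_2_measurable [measurable]:
  "(\<lambda>(x, y). vector [x, y] :: real^2) \<in> lborel \<Otimes>\<^sub>M lborel \<rightarrow>\<^sub>M borel"
proof -
  have "(\<lambda>p::real \<times> real. fst p *\<^sub>R axis 1 1 + snd p *\<^sub>R axis 2 1 :: real^2) \<in> borel \<rightarrow>\<^sub>M borel"
    by (intro borel_measurable_continuous_onI continuous_intros)
  then show ?thesis
    by (simp add: vector_2_eq case_prod_unfold lborel_prod)
qed

text \<open>Volumes of boxes determine Lebesgue measure. The identification opens planar integrals
  to Fubini.\<close>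

lemma lborel_vector_2:
  "(lborel :: (real^2) measure) = distr (lborel \<Otimes>\<^sub>M lborel) borel (\<lambda>(x, y). vector [x, y])"
proof (rule lborel_eqI)
  fix l u :: "real^2"
  assume le: "\<And>b. b \<in> Basis \<Longrightarrow> l \<bullet> b \<le> u \<bullet> b"
  have Basis2: "(Basis :: (real^2) set) = {axis 1 1, axis 2 1}"
    by (auto simp: Basis_vec_def UNIV_2)
  have ne: "axis 1 1 \<noteq> (axis 2 1 :: real^2)"
    by (simp add: axis_eq_axis)
  have le': "l$1 \<le> u$1" "l$2 \<le> u$2"
    using le[of "axis 1 1"] le[of "axis 2 1"] by (simp_all add: Basis2 inner_axis)
  have "(\<lambda>(x, y). vector [x, y] :: real^2) -` box l u \<inter> space (lborel \<Otimes>\<^sub>M lborel)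
      = {l$1<..<u$1} \<times> {l$2<..<u$2}"
    by (auto simp: mem_box_cart forall_2 space_pair_measure)
  then have "emeasure (distr (lborel \<Otimes>\<^sub>M lborel) borel (\<lambda>(x, y). vector [x, y] :: real^2)) (box l u)
      = emeasure (lborel \<Otimes>\<^sub>M lborel) ({l$1<..<u$1} \<times> {l$2<..<u$2})"
    by (subst emeasure_distr) auto
  also have "\<dots> = ennreal (u$1 - l$1) * ennreal (u$2 - l$2)"
    using le' by (subst lborel.emeasure_pair_measure_Times) auto
  also have "\<dots> = (\<Prod>b\<in>Basis. (u - l) \<bullet> b)"
    using le' by (simp add: Basis2 ne inner_axis ennreal_mult'')
  finally show "emeasure (distr (lborel \<Otimes>\<^sub>M lborel) borel (\<lambda>(x, y). vector [x, y] :: real^2)) (box l u)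
      = (\<Prod>b\<in>Basis. (u - l) \<bullet> b)" .
qed simp

section \<open>Bivariate normal law with a given covariance matrix\<close>

definition cov2 :: "real \<Rightarrow> real \<Rightarrow> real \<Rightarrow> real^2^2" where
  "cov2 a c b = vector [vector [a, c], vector [c, b]]"

lemma quadratic_form_cov2:
  "x \<bullet> (cov2 a c b *v x) = a * (x$1)\<^sup>2 + 2 * c * x$1 * x$2 + b * (x$2)\<^sup>2"
  by (simp add: inner_vec_def sum_2 matrix_vector_mult_def cov2_def algebra_simps power2_eq_square)

lemma det_cov2: "det (cov2 a c b) = a * b - c\<^sup>2"
  by (simp add: det_2 cov2_def power2_eq_square)

context
  fixes a b c :: real
  assumes a: "a > 0" and det: "a * b - c\<^sup>2 > 0"
begin

text \<open>Multiplying the form by \<open>a\<close> and completing the square leaves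
  \<open>a * b - c\<^sup>2\<close> times the square of the second coordinate.\<close>

lemma positive_definite_cov2: "positive_definite (cov2 a c b)"
  unfolding positive_definite_def
proof (intro conjI allI impI)
  show "transpose (cov2 a c b) = cov2 a c b"
    by (simp add: transpose_def cov2_def vec_eq_iff forall_2)
  fix x :: "real^2" assume "x \<noteq> 0"
  then have x: "x$1 \<noteq> 0 \<or> x$2 \<noteq> 0" by (simp add: vec_eq_iff forall_2)
  have "a * (x \<bullet> (cov2 a c b *v x)) = (a * x$1 + c * x$2)\<^sup>2 + (a * b - c\<^sup>2) * (x$2)\<^sup>2"
    unfolding quadratic_form_cov2 by (simp add: algebra_simps power2_eq_square)
  also have "\<dots> > 0"
  proof (cases "x$2 = 0")
    case True
    with x a show ?thesis by simp
  next
    case False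
    then have "(a * b - c\<^sup>2) * (x$2)\<^sup>2 > 0" using det by simp
    then show ?thesis by (rule add_nonneg_pos[rotated]) simp
  qed
  finally show "x \<bullet> (cov2 a c b *v x) > 0" using a by (simp add: zero_less_mult_iff)
qed

text \<open>The factors are the marginal density of the first coordinate and the conditional density
  of the second, with regression slope \<open>c / a\<close> and residual variance
  \<open>b - c\<^sup>2 / a\<close>, the Schur complement.\<close>

lemma multivariate_normal_density_cov2:
  "multivariate_normal_density 0 (cov2 a c b) (vector [x, y])
    = normal_density 0 (sqrt a) x * normal_density (c / a * x) (sqrt (b - c\<^sup>2 / a)) y"
proof -
  define D where "D = a * b - c\<^sup>2"
  have D: "D > 0" using det by (simp add: D_def)
  have inv: "matrix_inv (cov2 a c b) = cov2 (b / D) (- c / D) (a / D)"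
  proof (rule matrix_inv_eqI)
    have "a * (b / D) + c * (- c / D) = 1" "c * (- c / D) + b * (a / D) = 1"
      using D by (simp_all add: D_def diff_divide_distrib[symmetric] mult.commute power2_eq_square)
    then show "cov2 a c b ** cov2 (b / D) (- c / D) (a / D) = mat 1"
      "cov2 (b / D) (- c / D) (a / D) ** cov2 a c b = mat 1"
      by (simp_all add: vec_eq_iff forall_2 matrix_matrix_mult_def sum_2 mat_def cov2_def mult_ac add_ac)
  qed
  have s2: "b - c\<^sup>2 / a = D / a" using a by (simp add: D_def field_simps)
  have "normal_density 0 (sqrt a) x * normal_density (c / a * x) (sqrt (b - c\<^sup>2 / a)) y
    = 1 / (sqrt (2 * pi * a) * sqrt (2 * pi * (D / a))) *
      exp (- x\<^sup>2 / (2 * a) + - (y - c / a * x)\<^sup>2 / (2 * (D / a)))"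
    using a D by (simp add: normal_density_def s2 mult_exp_exp)
  also have "sqrt (2 * pi * a) * sqrt (2 * pi * (D / a)) = sqrt ((2 * pi) ^ 2 * D)"
    using a by (simp add: real_sqrt_mult[symmetric] power2_eq_square mult_ac)
  also have "- x\<^sup>2 / (2 * a) + - (y - c / a * x)\<^sup>2 / (2 * (D / a))
      = - (b / D * x\<^sup>2 + 2 * (- c / D) * x * y + a / D * y\<^sup>2) / 2"
  proof -
    have "D * x\<^sup>2 + (a * y - c * x)\<^sup>2 = a * (b * x\<^sup>2 - 2 * c * x * y + a * y\<^sup>2)"
      by (simp add: D_def algebra_simps power2_eq_square)
    then have E: "(a * y - c * x)\<^sup>2 = a * (b * x\<^sup>2 - 2 * c * x * y + a * y\<^sup>2) - D * x\<^sup>2"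
      by linarith
    have "y - c / a * x = (a * y - c * x) / a" using a by (simp add: field_simps)
    then have "(y - c / a * x)\<^sup>2 = (a * (b * x\<^sup>2 - 2 * c * x * y + a * y\<^sup>2) - D * x\<^sup>2) / a\<^sup>2"
      by (simp add: power_divide E)
    then show ?thesis
      using a D by (simp add: divide_simps) (simp add: algebra_simps power2_eq_square)
  qed
  finally show ?thesis
    unfolding multivariate_normal_density_def inv diff_zero quadratic_form_cov2 det_cov2
    by (simp add: D_def)
qed

lemma mvn_nonneg: "multivariate_normal_density 0 (cov2 a c b) x \<ge> 0"
  using det by (simp add: multivariate_normal_density_def det_cov2)

lemma mvn_measurable [measurable]:
  "multivariate_normal_density 0 (cov2 a c b) \<in> borel_measurable borel"
proof (rule borel_measurable_continuous_onI)
  have "continuous_on UNIV (\<lambda>x :: real^2. matrix_inv (cov2 a c b) *v x)"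
    by (simp add: linear_continuous_on linear_linear)
  then show "continuous_on UNIV (multivariate_normal_density 0 (cov2 a c b))"
    unfolding multivariate_normal_density_def using det
    by (intro continuous_intros) (auto simp: det_cov2)
qed

lemma prob_space_mvn:
  "prob_space (density lborel (\<lambda>x. ennreal (multivariate_normal_density 0 (cov2 a c b) x)))"
proof
  have s: "b - c\<^sup>2 / a > 0" using a det by (simp add: field_simps)
  have "emeasure (density lborel (\<lambda>x. ennreal (multivariate_normal_density 0 (cov2 a c b) x))) UNIV
      = (\<integral>\<^sup>+x. ennreal (multivariate_normal_density 0 (cov2 a c b) x) \<partial>lborel)"
    by (subst emeasure_density) auto
  also have "\<dots> = (\<integral>\<^sup>+p. ennreal (multivariate_normal_density 0 (cov2 a c b) (case p of (x, y) \<Rightarrow> vector [x, y])) \<partial>(lborel \<Otimes>\<^sub>M lborel))"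
    unfolding lborel_vector_2 by (subst nn_integral_distr) auto
  also have "\<dots> = (\<integral>\<^sup>+x. \<integral>\<^sup>+y. ennreal (multivariate_normal_density 0 (cov2 a c b) (vector [x, y])) \<partial>lborel \<partial>lborel)"
    by (subst lborel.nn_integral_fst[symmetric]) auto
  also have "\<dots> = (\<integral>\<^sup>+x. \<integral>\<^sup>+y. ennreal (normal_density 0 (sqrt a) x) * ennreal (normal_density (c / a * x) (sqrt (b - c\<^sup>2 / a)) y) \<partial>lborel \<partial>lborel)"
    by (simp add: multivariate_normal_density_cov2 ennreal_mult)
  also have "\<dots> = 1"
    using a s by (simp add: nn_integral_cmult nn_integral_normal_density)
  finally show "emeasure (density lborel (\<lambda>x. ennreal (multivariate_normal_density 0 (cov2 a c b) x)))
     (space (density lborel (\<lambda>x. ennreal (multivariate_normal_density 0 (cov2 a c b) x)))) = 1"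
    by simp
qed

text \<open>Integrating over the second coordinate first yields a constant and the phase
  \<open>t$2 * (c / a * x)\<close>. Being linear in \<open>x\<close>, this phase merges into the
  frequency of the first coordinate, and a one-dimensional normal integral remains.\<close>

lemma integral_mvn_cis:
  "(\<integral>x. cis (t \<bullet> x) \<partial>density lborel (\<lambda>x. ennreal (multivariate_normal_density 0 (cov2 a c b) x)))
    = exp (- (a * (t$1)\<^sup>2 + 2 * c * t$1 * t$2 + b * (t$2)\<^sup>2) / 2)"
proof -
  let ?f = "multivariate_normal_density 0 (cov2 a c b)"
  let ?v = "\<lambda>(x, y). vector [x, y] :: real^2"
  define r where "r = b - c\<^sup>2 / a"
  have r: "r > 0" using a det by (simp add: r_def field_simps)
  have cis_meas [measurable]: "(\<lambda>x. cis (t \<bullet> x)) \<in> borel_measurable borel"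
    by (intro borel_measurable_continuous_onI continuous_intros)
  have "integrable (density lborel (\<lambda>x. ennreal (?f x))) (\<lambda>x. cis (t \<bullet> x))"
    by (rule trig_poly_integrable[OF trig_poly.cis prob_space_mvn]) simp
  then have "integrable lborel (\<lambda>x. ?f x *\<^sub>R cis (t \<bullet> x))"
    by (subst (asm) integrable_density) (auto simp: mvn_nonneg)
  then have int: "integrable (lborel \<Otimes>\<^sub>M lborel) (\<lambda>p. ?f (?v p) *\<^sub>R cis (t \<bullet> ?v p))"
    unfolding lborel_vector_2 by (subst (asm) integrable_distr_eq) auto
  have "(\<integral>x. cis (t \<bullet> x) \<partial>density lborel (\<lambda>x. ennreal (?f x))) = (\<integral>x. ?f x *\<^sub>R cis (t \<bullet> x) \<partial>lborel)"
    by (subst integral_density) (auto simp: mvn_nonneg)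
  also have "\<dots> = (\<integral>p. ?f (?v p) *\<^sub>R cis (t \<bullet> ?v p) \<partial>(lborel \<Otimes>\<^sub>M lborel))"
    unfolding lborel_vector_2 by (subst integral_distr) auto
  also have "\<dots> = (\<integral>x. \<integral>y. ?f (vector [x, y]) *\<^sub>R cis (t \<bullet> vector [x, y]) \<partial>lborel \<partial>lborel)"
    using lborel_pair.integral_fst'[OF int] by simp
  also have "\<dots> = (\<integral>x. \<integral>y. normal_density 0 (sqrt a) x *\<^sub>R cis (t$1 * x) *
        (normal_density (c / a * x) (sqrt r) y *\<^sub>R cis (t$2 * y)) \<partial>lborel \<partial>lborel)"
    by (intro Bochner_Integration.integral_cong)
       (simp_all add: multivariate_normal_density_cov2 inner_vec_def sum_2 r_def cis_mult)
  also have "\<dots> = (\<integral>x. normal_density 0 (sqrt a) x *\<^sub>R cis (t$1 * x) *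
        (cis (t$2 * (c / a * x)) * exp (- (sqrt r * t$2)\<^sup>2 / 2)) \<partial>lborel)"
    using r by (simp only: integral_mult_right_zero integral_normal_density_cis real_sqrt_gt_zero)
  also have "\<dots> = (\<integral>x. exp (- (sqrt r * t$2)\<^sup>2 / 2) * (normal_density 0 (sqrt a) x *\<^sub>R cis ((t$1 + t$2 * c / a) * x)) \<partial>lborel)"
    by (intro Bochner_Integration.integral_cong)
       (simp_all add: cis_mult algebra_simps add_divide_distrib)
  also have "\<dots> = exp (- (sqrt r * t$2)\<^sup>2 / 2) * exp (- (sqrt a * (t$1 + t$2 * c / a))\<^sup>2 / 2)"
    using a by (simp only: integral_mult_right_zero integral_normal_density_cis real_sqrt_gt_zero) simp
  also have "\<dots> = complex_of_real (exp (- (a * (t$1)\<^sup>2 + 2 * c * t$1 * t$2 + b * (t$2)\<^sup>2) / 2))"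
  proof -
    have "- (sqrt r * t$2)\<^sup>2 / 2 + - (sqrt a * (t$1 + t$2 * c / a))\<^sup>2 / 2
        = - (a * (t$1)\<^sup>2 + 2 * c * t$1 * t$2 + b * (t$2)\<^sup>2) / 2"
    proof -
      have sq: "(sqrt r * t$2)\<^sup>2 = r * (t$2)\<^sup>2"
        "(sqrt a * (t$1 + t$2 * c / a))\<^sup>2 = a * (t$1 + t$2 * c / a)\<^sup>2"
        using a r by (simp_all add: power_mult_distrib)
      show ?thesis
        unfolding sq using a by (simp add: r_def field_simps power2_eq_square)
    qed
    then show ?thesis by (simp flip: exp_add of_real_mult)
  qed
  finally show ?thesis by simp
qed

end

section \<open>Criteria for asymptotic normality\<close>

lemma asymptotically_normalI:
  assumes "\<sigma> > 0"
    and "\<And>t. (\<lambda>n. measure_pmf.expectation (p n) (\<lambda>\<omega>. cis (t * ((X n \<omega> - measure_pmf.expectation (p n) (X n)) / sqrt (real n)))))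
      \<longlonglongrightarrow> exp (- (\<sigma> * t)\<^sup>2 / 2)"
  shows "asymptotically_normal (\<lambda>n. measure_pmf (p n)) X"
proof -
  let ?X = "\<lambda>n \<omega>. (X n \<omega> - measure_pmf.expectation (p n) (X n)) / sqrt (real n)"
  have "weak_conv_m (\<lambda>n. distr (p n) borel (?X n)) (density lborel (\<lambda>x. ennreal (normal_density 0 \<sigma> x)))"
  proof (rule levy_continuity)
    show "real_distribution (distr (p n) borel (?X n))" for n
      by (simp add: real_distribution_def real_distribution_axioms_def measure_pmf.prob_space_distr)
    show "real_distribution (density lborel (\<lambda>x. ennreal (normal_density 0 \<sigma> x)))"
      using prob_space_normal_density[OF \<open>\<sigma> > 0\<close>]
      by (simp add: real_distribution_def real_distribution_axioms_def)
    fix t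
    have "char (density lborel (\<lambda>x. ennreal (normal_density 0 \<sigma> x))) t
        = (\<integral>x. normal_density 0 \<sigma> x *\<^sub>R cis (t * x) \<partial>lborel)"
      unfolding char_def by (subst integral_density) (auto simp: cis_conv_exp)
    also have "\<dots> = exp (- (\<sigma> * t)\<^sup>2 / 2)"
      using integral_normal_density_cis[OF \<open>\<sigma> > 0\<close>, of 0 t] by simp
    finally show "(\<lambda>n. char (distr (p n) borel (?X n)) t) \<longlonglongrightarrow>
        char (density lborel (\<lambda>x. ennreal (normal_density 0 \<sigma> x))) t"
      using assms(2)[of t] by (simp add: char_def integral_distr cis_conv_exp)
  qed
  then show ?thesis unfolding asymptotically_normal_def using \<open>\<sigma> > 0\<close> by blast
qed

text \<open>Expanding the variance of the sum reduces covariances to variances of linear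
  combinations, the only quantities that the martingale argument estimates.\<close>

lemma covariance_polarization:
  fixes X Y :: "'a \<Rightarrow> real"
  assumes [simp]: "finite (set_pmf p)"
  shows "covariance p X Y = (measure_pmf.variance p (\<lambda>\<omega>. X \<omega> + Y \<omega>)
    - measure_pmf.variance p X - measure_pmf.variance p Y) / 2"
proof -
  have [simp]: "integrable p F" for F :: "'a \<Rightarrow> real"
    by (rule integrable_measure_pmf_finite) simp
  define x y where "x = measure_pmf.expectation p X" and "y = measure_pmf.expectation p Y"
  have "measure_pmf.variance p (\<lambda>\<omega>. X \<omega> + Y \<omega>) =
      measure_pmf.expectation p (\<lambda>\<omega>. (X \<omega> - x)\<^sup>2 + 2 * ((X \<omega> - x) * (Y \<omega> - y)) + (Y \<omega> - y)\<^sup>2)"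
    by (intro Bochner_Integration.integral_cong) (simp_all add: x_def y_def power2_eq_square algebra_simps)
  also have "\<dots> = measure_pmf.expectation p (\<lambda>\<omega>. (X \<omega> - x)\<^sup>2)
     + 2 * measure_pmf.expectation p (\<lambda>\<omega>. (X \<omega> - x) * (Y \<omega> - y)) + measure_pmf.expectation p (\<lambda>\<omega>. (Y \<omega> - y)\<^sup>2)"
    by (subst Bochner_Integration.integral_add, simp, simp)+ simp
  finally show ?thesis unfolding covariance_def x_def y_def by simp
qed

text \<open>The characteristic function of the normalised vector is that of a linear combination of
  the coordinates, and the variance bounds make its second moments uniformly bounded.\<close>

lemma asymptotically_jointly_normalI:
  fixes X Y :: "nat \<Rightarrow> 'a \<Rightarrow> real"
  assumes [simp]: "\<And>n. finite (set_pmf (p n))"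
    and a: "a > 0" and det: "a * b - c\<^sup>2 > 0"
    and char: "\<And>s t. (\<lambda>n. measure_pmf.expectation (p n) (\<lambda>\<omega>. cis ((s * (X n \<omega> - measure_pmf.expectation (p n) (X n))
        + t * (Y n \<omega> - measure_pmf.expectation (p n) (Y n))) / sqrt (real n))))
      \<longlonglongrightarrow> exp (- (a * s\<^sup>2 + 2 * c * s * t + b * t\<^sup>2) / 2)"
    and varX: "\<And>n. measure_pmf.variance (p n) (X n) \<le> K * real n"
    and varY: "\<And>n. measure_pmf.variance (p n) (Y n) \<le> K * real n"
  shows "asymptotically_jointly_normal (\<lambda>n. measure_pmf (p n)) (\<lambda>n \<omega>. vector [X n \<omega>, Y n \<omega>] :: real^2)"
proof -
  have int [simp]: "integrable (p n) F" for n and F :: "'a \<Rightarrow> 'c::{banach, second_countable_topology}"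
    by (rule integrable_measure_pmf_finite) simp
  define x y where "x n = measure_pmf.expectation (p n) (X n)" and "y n = measure_pmf.expectation (p n) (Y n)" for n
  let ?V = "\<lambda>n \<omega>. vector [X n \<omega>, Y n \<omega>] :: real^2"
  define Z where "Z n \<omega> = (?V n \<omega> - measure_pmf.expectation (p n) (?V n)) /\<^sub>R sqrt (real n)" for n \<omega>
  have mean: "measure_pmf.expectation (p n) (?V n) = vector [x n, y n]" for n
    unfolding vector_2_eq x_def y_def by simp
  have Z: "Z n \<omega> $ 1 = (X n \<omega> - x n) / sqrt (real n)" "Z n \<omega> $ 2 = (Y n \<omega> - y n) / sqrt (real n)" for n \<omega>
    by (simp_all add: Z_def mean divide_inverse mult.commute)
  have dot: "t \<bullet> Z n \<omega> = (t$1 * (X n \<omega> - x n) + t$2 * (Y n \<omega> - y n)) / sqrt (real n)" for t n \<omega>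
    by (simp add: inner_vec_def sum_2 Z add_divide_distrib)
  have norm: "(norm (Z n \<omega>))\<^sup>2 = ((X n \<omega> - x n)\<^sup>2 + (Y n \<omega> - y n)\<^sup>2) / real n" for n \<omega>
    unfolding dot_square_norm[symmetric] inner_vec_def
    by (simp add: sum_2 Z add_divide_distrib power2_eq_square[symmetric] power_divide)
  have "converges_weakly (\<lambda>n. distr (p n) borel (Z n)) (density lborel (\<lambda>x. ennreal (multivariate_normal_density 0 (cov2 a c b) x)))"
  proof (rule converges_weakly_char)
    show "prob_space (distr (p n) borel (Z n))" for n
      by (rule measure_pmf.prob_space_distr) simp
    show "prob_space (density lborel (\<lambda>x. ennreal (multivariate_normal_density 0 (cov2 a c b) x)))"
      by (rule prob_space_mvn[OF a det])
    have cis_meas: "(\<lambda>x. cis (t \<bullet> x)) \<in> borel_measurable borel" for t :: "real^2"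
      by (intro borel_measurable_continuous_onI continuous_intros)
    have "(\<integral>x. cis (t \<bullet> x) \<partial>distr (p n) borel (Z n)) = measure_pmf.expectation (p n) (\<lambda>\<omega>. cis (t \<bullet> Z n \<omega>))"
      for t n by (subst integral_distr) (auto simp: cis_meas)
    then show "(\<lambda>n. \<integral>x. cis (t \<bullet> x) \<partial>distr (p n) borel (Z n)) \<longlonglongrightarrow>
        (\<integral>x. cis (t \<bullet> x) \<partial>density lborel (\<lambda>x. ennreal (multivariate_normal_density 0 (cov2 a c b) x)))" for t
      using char[of "t$1" "t$2"] unfolding integral_mvn_cis[OF a det] dot x_def y_def by simp
    show "integrable (distr (p n) borel (Z n)) (\<lambda>x. (norm x)\<^sup>2)" for n
      by (subst integrable_distr_eq) auto
    \<comment> \<open>\<open>K\<close> carries no sign assumption, hence the absolute value. For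
      \<open>n = 0\<close> division by zero makes the left side 0.\<close>
    show "(\<integral>x. (norm x)\<^sup>2 \<partial>distr (p n) borel (Z n)) \<le> 2 * \<bar>K\<bar>" for n
    proof -
      have "(\<integral>x. (norm x)\<^sup>2 \<partial>distr (p n) borel (Z n)) =
         (measure_pmf.variance (p n) (X n) + measure_pmf.variance (p n) (Y n)) / real n"
        by (subst integral_distr) (auto simp: norm x_def y_def)
      also have "\<dots> \<le> 2 * \<bar>K\<bar>"
      proof (cases "n = 0")
        case False
        have "K * real n \<le> \<bar>K\<bar> * real n" by (intro mult_right_mono) auto
        then have "measure_pmf.variance (p n) (X n) + measure_pmf.variance (p n) (Y n) \<le> 2 * \<bar>K\<bar> * real n"
          using varX[of n] varY[of n] by linarith
        with False show ?thesis by (simp add: divide_le_eq)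
      qed simp
      finally show ?thesis .
    qed
  qed simp_all
  then show ?thesis
    unfolding asymptotically_jointly_normal_def Z_def using positive_definite_cov2[OF a det] by blast
qed

section \<open>The Markov chain of carries\<close>

lemma card_triangle: "2 * card {(u, v). u + v < n} = n * (n + 1)" for n :: nat
proof -
  have "{(u, v). u + v < n} = (SIGMA u:{..<n}. {..<n - u})" by auto
  then have "card {(u, v). u + v < n} = (\<Sum>u<n. n - u)" by simp
  also have "\<dots> = (\<Sum>u<n. Suc u)"
    by (rule sum.reindex_bij_witness[where i = "\<lambda>u. n - Suc u" and j = "\<lambda>u. n - Suc u"]) auto
  also have "2 * \<dots> = n * (n + 1)" by (induction n) auto
  finally show ?thesis .
qed

text \<open>The sign \<open>s\<close> treats two corners of the square of digit pairs at once:
  \<open>s * (a - p)\<close> and \<open>s * (b - p)\<close> are distances from the corner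
  \<open>p\<close>. For \<open>n \<le> q\<close> the triangle fits into the square. The value
  \<open>n = - 1\<close>, with an empty set, occurs for the extreme digit sets.\<close>

lemma card_int_triangle:
  fixes n q p s :: int
  assumes "- 1 \<le> n" "n \<le> q" "s = 1 \<or> s = - 1"
  shows "2 * int (card {(a, b). 0 \<le> s * (a - p) \<and> s * (a - p) < q \<and> 0 \<le> s * (b - p) \<and> s * (b - p) < q \<and>
      s * (a - p) + s * (b - p) < n}) = n * (n + 1)"
proof -
  have "bij_betw (\<lambda>(u, v). (p + s * int u, p + s * int v)) {(u, v). u + v < nat n}
     {(a, b). 0 \<le> s * (a - p) \<and> s * (a - p) < q \<and> 0 \<le> s * (b - p) \<and> s * (b - p) < q \<and>
      s * (a - p) + s * (b - p) < n}"
    using assms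
    by (intro bij_betwI[where g = "\<lambda>(a, b). (nat (s * (a - p)), nat (s * (b - p)))"]) auto
  from bij_betw_same_card[OF this] card_triangle[of "nat n"]
  have "2 * int (card {(a, b). 0 \<le> s * (a - p) \<and> s * (a - p) < q \<and> 0 \<le> s * (b - p) \<and> s * (b - p) < q \<and>
      s * (a - p) + s * (b - p) < n}) = int (nat n) * (int (nat n) + 1)"
    by (metis (no_types, lifting) of_nat_1 of_nat_add of_nat_mult of_nat_numeral)
  also have "\<dots> = n * (n + 1)"
    using assms(1) by (cases "n = - 1") auto
  finally show ?thesis .
qed

locale addition =
  fixes q d :: int
  assumes q: "q \<ge> 2" and d: "- q < d" "d \<le> 0"
begin

abbreviation "rs \<equiv> random_summands q d"

definition digit_pair :: "(int \<times> int) pmf" where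
  "digit_pair = pmf_of_set ({d..q + d - 1} \<times> {d..q + d - 1})"

definition next_carry :: "int \<Rightarrow> int \<times> int \<Rightarrow> int" where
  "next_carry c = (\<lambda>(a, b). if a + b + c \<ge> q + d then 1 else if a + b + c \<le> d - 1 then - 1 else 0)"

definition carry_kernel :: "int \<Rightarrow> int pmf" where
  "carry_kernel c = map_pmf (next_carry c) digit_pair"

definition carry_sum :: "(int \<Rightarrow> real) \<Rightarrow> nat \<Rightarrow> (nat \<Rightarrow> int) \<times> (nat \<Rightarrow> int) \<Rightarrow> real" where
  "carry_sum f l = (\<lambda>(x, y). \<Sum>j = 1..l. f (carry q d x y j))"

definition last_carry :: "nat \<Rightarrow> (nat \<Rightarrow> int) \<times> (nat \<Rightarrow> int) \<Rightarrow> int" where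
  "last_carry l = (\<lambda>(x, y). carry q d x y l)"

lemma finite_expansions: "finite (expansions q d l)" "expansions q d l \<noteq> {}"
  using q by (auto simp: expansions_def PiE_eq_empty_iff intro!: finite_PiE)

lemma set_rs: "set_pmf (rs l) = expansions q d l \<times> expansions q d l"
  using finite_expansions by (simp add: random_summands_def)

lemma finite_set_rs [simp]: "finite (set_pmf (rs l))"
  using finite_expansions by (simp add: set_rs)

lemma digit_pair_eq:
  "digit_pair = pair_pmf (pmf_of_set {d..q + d - 1}) (pmf_of_set {d..q + d - 1})"
  using q by (intro pmf_eqI) (auto simp: digit_pair_def pmf_pair indicator_def card_cartesian_product split: prod.split)

lemma carry_cong: "(\<And>i. i < j \<Longrightarrow> x i = x' i \<and> y i = y' i) \<Longrightarrow> carry q d x y j = carry q d x' y' j"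
  by (induction j) auto

lemma carry_range: "carry q d x y j \<in> {- 1, 0, 1}"
  by (cases j) (auto simp: Let_def)

lemma last_carry_range: "last_carry l \<omega> \<in> {- 1, 0, 1}"
  by (cases \<omega>) (simp only: last_carry_def carry_range prod.case)

text \<open>Placing a digit at position \<open>l\<close> is a bijection onto the longer words, so
  uniformity is inherited. The new digit is the most significant one, hence earlier carries do not
  see it.\<close>

lemma uniform_expansions_Suc:
  "pmf_of_set (expansions q d (Suc l)) =
     pmf_of_set (expansions q d l) \<bind> (\<lambda>x. map_pmf (\<lambda>a. x(l := a)) (pmf_of_set {d..q + d - 1}))"
proof -
  let ?D = "{d..q + d - 1}" and ?E = "expansions q d l"
  have "pmf_of_set (?D \<times> ?E) = pair_pmf (pmf_of_set ?D) (pmf_of_set ?E)"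
    using q finite_expansions
    by (intro pmf_eqI) (auto simp: pmf_pair indicator_def card_cartesian_product split: prod.split)
  moreover have "expansions q d (Suc l) = (\<lambda>(a, x). x(l := a)) ` (?D \<times> ?E)"
    by (simp add: expansions_def lessThan_Suc PiE_insert_eq)
  moreover have "inj_on (\<lambda>(a, x). x(l := a)) (?D \<times> ?E)"
    unfolding expansions_def by (rule inj_combinator) simp
  ultimately have "pmf_of_set (expansions q d (Suc l)) =
      map_pmf (\<lambda>(a, x). x(l := a)) (pair_pmf (pmf_of_set ?D) (pmf_of_set ?E))"
    using q finite_expansions by (simp flip: map_pmf_of_set_inj)
  then show ?thesis
    by (simp add: pair_pmf_def map_pmf_def bind_assoc_pmf bind_return_pmf)
       (rule bind_commute_pmf)
qed

lemma rs_Suc: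
  "rs (Suc l) = rs l \<bind> (\<lambda>(x, y). map_pmf (\<lambda>(a, b). (x(l := a), y(l := b))) digit_pair)"
  unfolding random_summands_def uniform_expansions_Suc digit_pair_eq
  by (simp add: pair_pmf_def map_pmf_def bind_assoc_pmf bind_return_pmf)
     (intro bind_pmf_cong refl bind_commute_pmf)

text \<open>This is the Markov property: the partial sum and the current carry are updated by two
  fresh digits, and the past enters only through this pair.\<close>

lemma expectation_Suc:
  fixes F :: "real \<Rightarrow> int \<Rightarrow> 'b::{banach, second_countable_topology}"
  shows "measure_pmf.expectation (rs (Suc l)) (\<lambda>\<omega>. F (carry_sum f (Suc l) \<omega>) (last_carry (Suc l) \<omega>))
    = measure_pmf.expectation (rs l) (\<lambda>\<omega>. measure_pmf.expectation (carry_kernel (last_carry l \<omega>))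
        (\<lambda>c. F (carry_sum f l \<omega> + f c) c))"
proof -
  let ?H = "\<lambda>\<omega>. F (carry_sum f (Suc l) \<omega>) (last_carry (Suc l) \<omega>)"
  let ?k = "\<lambda>(x, y). map_pmf (\<lambda>(a, b). (x(l := a), y(l := b))) digit_pair"
  have fin: "finite (set_pmf digit_pair)"
    using q by (simp add: digit_pair_def)
  have step: "?H (x(l := a), y(l := b)) =
      F (carry_sum f l (x, y) + f (next_carry (last_carry l (x, y)) (a, b))) (next_carry (last_carry l (x, y)) (a, b))"
    for x y a b
  proof -
    \<comment> \<open>Carry \<open>j\<close> depends only on digits below position \<open>j\<close>,
      so overwriting position \<open>l\<close> changes no carry up to \<open>l\<close>.\<close>
    have old: "carry q d (x(l := a)) (y(l := b)) j = carry q d x y j" if "j \<le> l" for j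
      using that by (intro carry_cong) auto
    then have "(\<Sum>j = 1..l. f (carry q d (x(l := a)) (y(l := b)) j)) = (\<Sum>j = 1..l. f (carry q d x y j))"
      by (intro sum.cong) auto
    then show ?thesis
      by (simp add: carry_sum_def last_carry_def next_carry_def old Let_def)
  qed
  have "measure_pmf.expectation (rs (Suc l)) ?H
      = (\<Sum>\<omega>\<in>set_pmf (rs l). pmf (rs l) \<omega> *\<^sub>R measure_pmf.expectation (?k \<omega>) ?H)"
    unfolding rs_Suc by (rule pmf_expectation_bind) (auto simp: fin)
  also have "\<dots> = measure_pmf.expectation (rs l) (\<lambda>\<omega>. measure_pmf.expectation (?k \<omega>) ?H)"
    by (rule integral_measure_pmf[symmetric]) simp_all
  also have "\<dots> = measure_pmf.expectation (rs l) (\<lambda>\<omega>. measure_pmf.expectation (carry_kernel (last_carry l \<omega>))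
        (\<lambda>c. F (carry_sum f l \<omega> + f c) c))"
    by (intro Bochner_Integration.integral_cong refl)
       (simp add: carry_kernel_def step case_prod_unfold split: prod.split)
  finally show ?thesis .
qed

lemma expectation_0:
  fixes F :: "real \<Rightarrow> int \<Rightarrow> 'b::{banach, second_countable_topology}"
  shows "measure_pmf.expectation (rs 0) (\<lambda>\<omega>. F (carry_sum f 0 \<omega>) (last_carry 0 \<omega>)) = F 0 0"
  by (simp add: carry_sum_def last_carry_def case_prod_unfold)

lemma set_carry_kernel: "set_pmf (carry_kernel c) \<subseteq> {- 1, 0, 1}"
  by (auto simp: carry_kernel_def next_carry_def split: if_splits)

text \<open>Carry 1 comes from a triangle at the upper corner \<open>q + d - 1\<close> of the
  square, carry -1 from one at the lower corner \<open>d\<close>; the strict bounds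
  \<open>q + d - 1 + c\<close> and \<open>- d - c\<close> on the summed distances rewrite the
  thresholds of \<open>next_carry\<close>.\<close>

lemma pmf_carry_kernel:
  assumes c: "c \<in> {- 1, 0, 1}"
  shows "pmf (carry_kernel c) 1 = (q + d - 1 + c) * (q + d + c) / (2 * q\<^sup>2)"
    and "pmf (carry_kernel c) (- 1) = (d + c) * (d + c - 1) / (2 * q\<^sup>2)"
proof -
  let ?D = "{d..q + d - 1} \<times> {d..q + d - 1}"
  have pmf: "pmf (carry_kernel c) t = 2 * real (card (?D \<inter> next_carry c -` {t})) / (2 * q\<^sup>2)" for t
    using q unfolding carry_kernel_def pmf_map digit_pair_def
    by (subst measure_pmf_of_set) (auto simp: power2_eq_square)
  have "?D \<inter> next_carry c -` {1} = {(a, b). 0 \<le> - 1 * (a - (q + d - 1)) \<and> - 1 * (a - (q + d - 1)) < q \<and>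
      0 \<le> - 1 * (b - (q + d - 1)) \<and> - 1 * (b - (q + d - 1)) < q \<and>
      - 1 * (a - (q + d - 1)) + - 1 * (b - (q + d - 1)) < q + d - 1 + c}"
    by (auto simp: next_carry_def split: if_splits)
  moreover have "2 * int (card \<dots>) = (q + d - 1 + c) * (q + d - 1 + c + 1)"
    using c q d by (intro card_int_triangle) auto
  ultimately have "2 * int (card (?D \<inter> next_carry c -` {1})) = (q + d - 1 + c) * (q + d + c)"
    by (simp only:) simp
  from arg_cong[OF this, of real_of_int]
  have "2 * real (card (?D \<inter> next_carry c -` {1})) = (q + d - 1 + c) * (q + d + c)"
    by simp
  then show "pmf (carry_kernel c) 1 = (q + d - 1 + c) * (q + d + c) / (2 * q\<^sup>2)"
    by (simp only: pmf)
  have "?D \<inter> next_carry c -` {- 1} = {(a, b). 0 \<le> 1 * (a - d) \<and> 1 * (a - d) < q \<and>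
      0 \<le> 1 * (b - d) \<and> 1 * (b - d) < q \<and> 1 * (a - d) + 1 * (b - d) < - d - c}"
    using q by (auto simp: next_carry_def split: if_splits)
  moreover have "2 * int (card \<dots>) = (- d - c) * (- d - c + 1)"
    using c q d by (intro card_int_triangle) auto
  ultimately have "2 * int (card (?D \<inter> next_carry c -` {- 1})) = (- d - c) * (- d - c + 1)"
    by (simp only:)
  also have "\<dots> = (d + c) * (d + c - 1)" by (simp add: algebra_simps)
  finally have "2 * int (card (?D \<inter> next_carry c -` {- 1})) = (d + c) * (d + c - 1)" .
  from arg_cong[OF this, of real_of_int]
  have "2 * real (card (?D \<inter> next_carry c -` {- 1})) = (d + c) * (d + c - 1)"
    by simp
  then show "pmf (carry_kernel c) (- 1) = (d + c) * (d + c - 1) / (2 * q\<^sup>2)"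
    by (simp only: pmf)
qed

end

section \<open>Moments and characteristic function of an additive functional\<close>

text \<open>The recursion preserves any upper bound that is at least the fixed point
  \<open>B / (1 - r)\<close>. It is meant for mixed moments of the partial sum and the
  carry.\<close>

lemma contraction_bounded:
  fixes a :: "nat \<Rightarrow> real"
  assumes "\<And>n. a (Suc n) \<le> r * a n + B" "0 \<le> r" "r < 1"
  shows "a n \<le> max (a 0) (B / (1 - r))"
proof (induction n)
  case (Suc n)
  define m where "m = max (a 0) (B / (1 - r))"
  have "B / (1 - r) \<le> m" by (simp add: m_def)
  then have "B \<le> m * (1 - r)" using assms(3) by (simp add: divide_le_eq)
  moreover have "a (Suc n) \<le> r * m + B"
    using assms(1)[of n] mult_left_mono[OF Suc assms(2)] unfolding m_def by linarith
  ultimately have "a (Suc n) \<le> m" by (simp add: algebra_simps)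
  then show ?case by (simp add: m_def)
qed simp

text \<open>The quadratic Taylor polynomial in \<theta> of a characteristic function with first
  moment \<open>x\<close> and second moment \<open>y\<close>. Up to cubic terms products obey the
  moment rule for sums: \<open>cis (\<theta> * a)\<close> has parameters \<open>a\<close> and
  \<open>a\<^sup>2\<close>, and multiplying by it gives \<open>a + x\<close> and
  \<open>a\<^sup>2 + 2 * a * x + y\<close>.\<close>

definition correction :: "real \<Rightarrow> real \<Rightarrow> real \<Rightarrow> complex" where
  "correction \<theta> x y = 1 + \<i> * of_real (\<theta> * x) - of_real (\<theta>\<^sup>2 * y / 2)"

lemma norm_correction_minus_1_le:
  assumes "\<bar>\<theta>\<bar> \<le> 1"
  shows "norm (correction \<theta> x y - 1) \<le> \<bar>\<theta>\<bar> * (\<bar>x\<bar> + \<bar>y\<bar>)"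
proof -
  have "norm (correction \<theta> x y - 1) \<le> norm (\<i> * of_real (\<theta> * x)) + norm (of_real (\<theta>\<^sup>2 * y / 2) :: complex)"
    unfolding correction_def by (simp only: add_diff_cancel_left' add_diff_eq[symmetric] norm_triangle_ineq4)
  also have "\<dots> = \<bar>\<theta>\<bar> * \<bar>x\<bar> + \<bar>\<theta>\<bar> * (\<bar>\<theta>\<bar> * (\<bar>y\<bar> / 2))"
    by (simp only: norm_mult norm_of_real norm_ii) (simp add: abs_mult power2_eq_square)
  also have "\<bar>\<theta>\<bar> * (\<bar>\<theta>\<bar> * (\<bar>y\<bar> / 2)) \<le> \<bar>\<theta>\<bar> * (1 * \<bar>y\<bar>)"
    using assms by (intro mult_left_mono mult_mono) auto
  finally show ?thesis by (simp add: distrib_left)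
qed

lemma norm_correction_le:
  assumes "\<bar>\<theta>\<bar> \<le> 1"
  shows "norm (correction \<theta> x y) \<le> 1 + \<bar>x\<bar> + \<bar>y\<bar>"
proof -
  have "norm (correction \<theta> x y) \<le> 1 + norm (correction \<theta> x y - 1)"
    using norm_triangle_ineq[of 1 "correction \<theta> x y - 1"] by simp
  moreover have "\<bar>\<theta>\<bar> * (\<bar>x\<bar> + \<bar>y\<bar>) \<le> 1 * (\<bar>x\<bar> + \<bar>y\<bar>)"
    using assms by (intro mult_right_mono) auto
  then have "norm (correction \<theta> x y - 1) \<le> 1 * (\<bar>x\<bar> + \<bar>y\<bar>)"
    by (rule order_trans[OF norm_correction_minus_1_le[OF assms]])
  ultimately show ?thesis by simp
qed

lemma cubic_bound:
  assumes "\<bar>\<theta>\<bar> \<le> (1::real)"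
  shows "norm (of_real (\<theta>^4 * x) - \<i> * of_real (\<theta>^3 * y)) \<le> \<bar>\<theta>\<bar>^3 * (\<bar>x\<bar> + \<bar>y\<bar>)"
proof -
  have "norm (of_real (\<theta>^4 * x) - \<i> * of_real (\<theta>^3 * y)) \<le> \<bar>\<theta>\<bar>^4 * \<bar>x\<bar> + \<bar>\<theta>\<bar>^3 * \<bar>y\<bar>"
    by (rule order_trans[OF norm_triangle_ineq4]) (simp add: norm_mult power_abs abs_mult del: of_real_mult of_real_power)
  also have "\<bar>\<theta>\<bar>^4 * \<bar>x\<bar> \<le> \<bar>\<theta>\<bar>^3 * \<bar>x\<bar>"
    using assms by (intro mult_right_mono power_decreasing) auto
  finally show ?thesis by (simp add: distrib_left)
qed

text \<open>Collects the Taylor remainder of \<open>cis\<close>, times a bound for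
  \<open>correction\<close>, and the coefficients of degree 4 and 3 left over in the product of two
  quadratic polynomials.\<close>

definition expansion_const1 :: "real \<Rightarrow> real \<Rightarrow> real \<Rightarrow> real" where
  "expansion_const1 a x y = \<bar>a\<bar>^3 / 6 * (1 + \<bar>x\<bar> + \<bar>y\<bar>) + (\<bar>a\<^sup>2 * y / 4\<bar> + \<bar>(a * y + a\<^sup>2 * x) / 2\<bar>)"

lemma cis_correction:
  assumes "\<bar>\<theta>\<bar> \<le> 1"
  shows "norm (cis (\<theta> * a) * correction \<theta> x y - correction \<theta> (a + x) (a\<^sup>2 + 2 * a * x + y))
    \<le> \<bar>\<theta>\<bar>^3 * expansion_const1 a x y"
proof -
  let ?u = "correction \<theta> x y"
  let ?c = "correction \<theta> a (a\<^sup>2)"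
  have "norm (cis (\<theta> * a) - ?c) \<le> \<bar>\<theta>\<bar>^3 * (\<bar>a\<bar>^3 / 6)"
  proof -
    have "(\<Sum>k\<le>2. (\<i> * complex_of_real (\<theta> * a))^k / fact k) = ?c"
      by (simp add: correction_def eval_nat_numeral power_mult_distrib algebra_simps)
    moreover have "\<bar>\<theta> * a\<bar> ^ Suc 2 / fact (Suc 2) = \<bar>\<theta>\<bar>^3 * (\<bar>a\<bar>^3 / 6)"
      by (simp add: abs_mult power_mult_distrib fact_numeral)
    ultimately show ?thesis
      using iexp_approx1[of "\<theta> * a" 2] by (simp only: cis_conv_exp)
  qed
  then have 1: "norm ((cis (\<theta> * a) - ?c) * ?u) \<le> \<bar>\<theta>\<bar>^3 * (\<bar>a\<bar>^3 / 6) * (1 + \<bar>x\<bar> + \<bar>y\<bar>)"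
    unfolding norm_mult by (intro mult_mono norm_correction_le assms) auto
  have "?c * ?u - correction \<theta> (a + x) (a\<^sup>2 + 2 * a * x + y) =
      of_real (\<theta>^4 * (a\<^sup>2 * y / 4)) - \<i> * of_real (\<theta>^3 * ((a * y + a\<^sup>2 * x) / 2))"
    by (simp add: correction_def complex_eq_iff field_simps eval_nat_numeral)
  with cubic_bound[OF assms, of "a\<^sup>2 * y / 4" "(a * y + a\<^sup>2 * x) / 2"]
  have 2: "norm (?c * ?u - correction \<theta> (a + x) (a\<^sup>2 + 2 * a * x + y)) \<le>
      \<bar>\<theta>\<bar>^3 * (\<bar>a\<^sup>2 * y / 4\<bar> + \<bar>(a * y + a\<^sup>2 * x) / 2\<bar>)" by (simp only:)
  have "cis (\<theta> * a) * ?u - correction \<theta> (a + x) (a\<^sup>2 + 2 * a * x + y) =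
     (cis (\<theta> * a) - ?c) * ?u + (?c * ?u - correction \<theta> (a + x) (a\<^sup>2 + 2 * a * x + y))"
    by (simp add: algebra_simps)
  then show ?thesis
    using norm_triangle_le[OF add_mono[OF 1 2]] by (simp add: expansion_const1_def algebra_simps)
qed

text \<open>The upper bound rests on (1 - x + x^2/2)(1 + x + x^2/2) = 1 + x^4/4 \<ge> 1 and on exp x
  \<ge> 1 + x + x^2/2.\<close>

lemma exp_minus_approx:
  fixes x :: real
  assumes "0 \<le> x"
  shows "\<bar>exp (- x) - (1 - x)\<bar> \<le> x\<^sup>2 / 2"
proof -
  have "1 - x \<le> exp (- x)" using exp_ge_add_one_self[of "- x"] by simp
  moreover have "exp (- x) \<le> 1 - x + x\<^sup>2 / 2"
  proof -
    have "(x - 1)\<^sup>2 \<ge> 0" by simp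
    then have pos: "1 - x + x\<^sup>2 / 2 > 0" by (simp add: power2_eq_square algebra_simps)
    have "1 \<le> 1 + x^4 / 4" by simp
    also have "\<dots> = (1 - x + x\<^sup>2 / 2) * (1 + x + x\<^sup>2 / 2)"
      by (simp add: field_simps eval_nat_numeral)
    also have "\<dots> \<le> (1 - x + x\<^sup>2 / 2) * exp x"
      using exp_lower_Taylor_quadratic[OF assms] pos by (intro mult_left_mono) auto
    finally show ?thesis by (simp add: exp_minus field_simps)
  qed
  ultimately show ?thesis by linarith
qed

text \<open>The same bookkeeping, with \<open>v\<^sup>2 / 8\<close> from the quadratic remainder of
  the exponential at \<open>\<theta>\<^sup>2 * v / 2\<close>.\<close>

definition expansion_const2 :: "real \<Rightarrow> real \<Rightarrow> real \<Rightarrow> real" where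
  "expansion_const2 v x y = v\<^sup>2 / 8 * (1 + \<bar>x\<bar> + \<bar>y\<bar>) + (\<bar>v * y / 4\<bar> + \<bar>v * x / 2\<bar>)"

text \<open>Multiplying by the approximate eigenvalue adds \<open>v\<close> to the second-moment
  parameter, which matches the constant that the Poisson equation leaves over.\<close>

lemma exp_correction:
  assumes "\<bar>\<theta>\<bar> \<le> 1" "0 \<le> v"
  shows "norm (of_real (exp (- (\<theta>\<^sup>2 * v / 2))) * correction \<theta> x y - correction \<theta> x (y + v))
    \<le> \<bar>\<theta>\<bar>^3 * expansion_const2 v x y"
proof -
  let ?u = "correction \<theta> x y"
  define z where "z = \<theta>\<^sup>2 * v / 2"
  have "\<bar>exp (- z) - (1 - z)\<bar> \<le> z\<^sup>2 / 2"
    using assms by (intro exp_minus_approx) (simp add: z_def)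
  also have "z\<^sup>2 / 2 = \<bar>\<theta>\<bar>^4 * (v\<^sup>2 / 8)"
    by (simp add: z_def power_mult_distrib power_divide)
  also have "\<dots> \<le> \<bar>\<theta>\<bar>^3 * (v\<^sup>2 / 8)"
    using assms by (intro mult_right_mono power_decreasing) auto
  finally have "norm (complex_of_real (exp (- z)) - of_real (1 - z)) \<le> \<bar>\<theta>\<bar>^3 * (v\<^sup>2 / 8)"
    by (simp only: of_real_diff[symmetric] norm_of_real)
  then have 1: "norm ((of_real (exp (- z)) - of_real (1 - z)) * ?u) \<le> \<bar>\<theta>\<bar>^3 * (v\<^sup>2 / 8) * (1 + \<bar>x\<bar> + \<bar>y\<bar>)"
    unfolding norm_mult by (intro mult_mono norm_correction_le assms) auto
  have "of_real (1 - z) * ?u - correction \<theta> x (y + v) =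
      of_real (\<theta>^4 * (v * y / 4)) - \<i> * of_real (\<theta>^3 * (v * x / 2))"
    by (simp add: correction_def z_def complex_eq_iff field_simps eval_nat_numeral)
  with cubic_bound[OF assms(1), of "v * y / 4" "v * x / 2"]
  have 2: "norm (of_real (1 - z) * ?u - correction \<theta> x (y + v)) \<le>
      \<bar>\<theta>\<bar>^3 * (\<bar>v * y / 4\<bar> + \<bar>v * x / 2\<bar>)" by (simp only:)
  have "of_real (exp (- z)) * ?u - correction \<theta> x (y + v) =
     (of_real (exp (- z)) - of_real (1 - z)) * ?u + (of_real (1 - z) * ?u - correction \<theta> x (y + v))"
    by (simp add: algebra_simps)
  then show ?thesis
    using norm_triangle_le[OF add_mono[OF 1 2]]
    by (simp add: expansion_const2_def z_def algebra_simps)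
qed

section \<open>Transfer operator and Poisson equation\<close>

context addition
begin

abbreviation "Q \<equiv> real_of_int q"
abbreviation "D \<equiv> real_of_int d"

lemma QD: "Q \<ge> 2"
  using q by linarith

abbreviation transfer :: "(int \<Rightarrow> 'b::{banach, second_countable_topology}) \<Rightarrow> int \<Rightarrow> 'b" where
  "transfer F c \<equiv> measure_pmf.expectation (carry_kernel c) F"

lemma finite_carry_kernel [simp]: "finite (set_pmf (carry_kernel c))"
  using set_carry_kernel by (rule finite_subset) simp

lemma transfer_sum:
  "transfer F c = pmf (carry_kernel c) 1 *\<^sub>R F 1 + pmf (carry_kernel c) (- 1) *\<^sub>R F (- 1)
     + pmf (carry_kernel c) 0 *\<^sub>R F 0"
proof -
  have "transfer F c = (\<Sum>a\<in>{1, - 1, 0}. pmf (carry_kernel c) a *\<^sub>R F a)"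
    by (rule integral_measure_pmf) (use set_carry_kernel in blast)+
  then show ?thesis by (simp add: add.assoc)
qed

lemma sum_carry_kernel:
  "pmf (carry_kernel c) 1 + pmf (carry_kernel c) (- 1) + pmf (carry_kernel c) 0 = 1"
  using transfer_sum[where F = "\<lambda>_. 1 :: real"] by simp

lemma norm_transfer_le:
  assumes "\<And>c. c \<in> {- 1, 0, 1} \<Longrightarrow> norm (F c) \<le> B"
  shows "norm (transfer F c) \<le> B"
proof -
  have "norm (transfer F c) \<le> pmf (carry_kernel c) 1 * B + pmf (carry_kernel c) (- 1) * B
     + pmf (carry_kernel c) 0 * B"
    unfolding transfer_sum
    by (intro norm_triangle_mono) (auto intro!: mult_left_mono assms)
  also have "\<dots> = B"
    using sum_carry_kernel[of c] by (metis distrib_right mult_1)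
  finally show ?thesis .
qed

text \<open>On three points every function has the form
  \<open>F 0 + lin F * c + quad F * c\<^sup>2\<close>; \<open>lin\<close> and \<open>quad\<close>
  are the interpolation coefficients.\<close>

definition lin :: "(int \<Rightarrow> real) \<Rightarrow> real" where "lin F = (F 1 - F (- 1)) / 2"
definition quad :: "(int \<Rightarrow> real) \<Rightarrow> real" where "quad F = (F 1 + F (- 1)) / 2 - F 0"

text \<open>From carry \<open>c\<close> the next carry has mean \<open>\<alpha> + c / Q\<close> and
  second moment \<open>\<beta> + \<gamma> * c + c\<^sup>2 / Q\<^sup>2\<close>.\<close>

definition "\<alpha> = (Q + 2 * D - 1) / (2 * Q)"
definition "\<beta> = ((Q + D - 1) * (Q + D) + D * (D - 1)) / (2 * Q\<^sup>2)"
definition "\<gamma> = (Q + 2 * D - 1) / Q\<^sup>2"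

text \<open>In the basis \<open>1, c, c\<^sup>2\<close> of the functions on the carries, the transfer operator is
  triangular with eigenvalues \<open>1, 1/q, 1/q\<^sup>2\<close>.\<close>

lemma transfer_eq:
  fixes F :: "int \<Rightarrow> real"
  assumes c: "c \<in> {- 1, 0, 1}"
  shows "transfer F c = F 0 + lin F * (\<alpha> + c / Q) + quad F * (\<beta> + \<gamma> * c + (real_of_int c)\<^sup>2 / Q\<^sup>2)"
proof -
  let ?p = "pmf (carry_kernel c)"
  \<comment> \<open>Both probabilities have the same \<open>c\<^sup>2\<close> term; its cancellation
    in the difference is what makes the operator triangular.\<close>
  have "?p 1 - ?p (- 1) = \<alpha> + c / Q"
    unfolding pmf_carry_kernel[OF c] using QD
    by (simp add: \<alpha>_def divide_simps) (simp add: algebra_simps power2_eq_square)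
  moreover have "?p 1 + ?p (- 1) = \<beta> + \<gamma> * c + (real_of_int c)\<^sup>2 / Q\<^sup>2"
    unfolding pmf_carry_kernel[OF c] using QD
    by (simp add: \<beta>_def \<gamma>_def divide_simps) (simp add: algebra_simps power2_eq_square)
  moreover have "transfer F c = F 0 + lin F * (?p 1 - ?p (- 1)) + quad F * (?p 1 + ?p (- 1))"
  proof -
    have p0: "?p 0 = 1 - ?p 1 - ?p (- 1)" using sum_carry_kernel[of c] by linarith
    show ?thesis unfolding transfer_sum p0 lin_def quad_def by (simp add: field_simps)
  qed
  ultimately show ?thesis by simp
qed

text \<open>\<open>stationary F\<close> is the expectation of \<open>F\<close> under the stationary distribution of the carries,
  and \<open>poisson F\<close> solves the Poisson equation for \<open>F\<close>.\<close>

definition poisson2 :: "(int \<Rightarrow> real) \<Rightarrow> real" where "poisson2 F = quad F / (Q\<^sup>2 - 1)"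
definition poisson1 :: "(int \<Rightarrow> real) \<Rightarrow> real" where
  "poisson1 F = (lin F + Q * \<gamma> * (quad F + poisson2 F)) / (Q - 1)"
definition poisson :: "(int \<Rightarrow> real) \<Rightarrow> int \<Rightarrow> real" where
  "poisson F c = poisson1 F * c + poisson2 F * (real_of_int c)\<^sup>2"
definition stationary :: "(int \<Rightarrow> real) \<Rightarrow> real" where
  "stationary F = F 0 + (lin F + poisson1 F) * \<alpha> + (quad F + poisson2 F) * \<beta>"

lemma poisson_0 [simp]: "poisson F 0 = 0"
  by (simp add: poisson_def)

text \<open>Coefficients are compared from the top degree down: \<open>c\<^sup>2\<close> fixes
  \<open>poisson2\<close>, then \<open>c\<close> fixes \<open>poisson1\<close>, and the constant
  left over is \<open>stationary F\<close>. The free constant of the solution is chosen to make it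
  vanish at carry 0, the initial state.\<close>

lemma transfer_poisson:
  assumes c: "c \<in> {- 1, 0, 1}"
  shows "transfer (\<lambda>c. F c + poisson F c) c = poisson F c + stationary F"
proof -
  have Q1: "Q - 1 \<noteq> 0" "Q\<^sup>2 - 1 \<noteq> 0" "Q \<noteq> 0"
    using QD power_mono[of 2 Q 2] by auto
  have [simp]: "lin (\<lambda>c. F c + poisson F c) = lin F + poisson1 F"
    "quad (\<lambda>c. F c + poisson F c) = quad F + poisson2 F"
    by (simp_all add: lin_def quad_def poisson_def field_simps)
  have 2: "(quad F + poisson2 F) / Q\<^sup>2 = poisson2 F"
    using Q1 by (simp add: poisson2_def divide_simps) (simp add: algebra_simps)
  have 1: "(lin F + poisson1 F) / Q + (quad F + poisson2 F) * \<gamma> = poisson1 F"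
    using Q1 by (simp add: poisson1_def divide_simps) (simp add: algebra_simps)
  have "transfer (\<lambda>c. F c + poisson F c) c = stationary F
     + ((lin F + poisson1 F) / Q + (quad F + poisson2 F) * \<gamma>) * c
     + ((quad F + poisson2 F) / Q\<^sup>2) * (real_of_int c)\<^sup>2"
    unfolding transfer_eq[OF c] stationary_def by (simp add: field_simps)
  then show ?thesis unfolding 1 2 by (simp add: poisson_def)
qed

definition E :: "(int \<Rightarrow> real) \<Rightarrow> nat \<Rightarrow> (real \<Rightarrow> int \<Rightarrow> 'b::{banach, second_countable_topology}) \<Rightarrow> 'b" where
  "E f l F = measure_pmf.expectation (rs l) (\<lambda>\<omega>. F (carry_sum f l \<omega>) (last_carry l \<omega>))"

lemma E_0: "E f 0 F = F 0 0"
  unfolding E_def by (rule expectation_0)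

lemma E_Suc: "E f (Suc l) F = E f l (\<lambda>s c. transfer (\<lambda>c. F (s + f c) c) c)"
  unfolding E_def by (rule expectation_Suc)

lemma integrable_rs [simp]:
  "integrable (measure_pmf (rs l)) (F :: _ \<Rightarrow> 'b::{banach, second_countable_topology})"
  by (rule integrable_measure_pmf_finite) simp

lemma integrable_carry_kernel [simp]:
  "integrable (measure_pmf (carry_kernel c)) (F :: _ \<Rightarrow> 'b::{banach, second_countable_topology})"
  by (rule integrable_measure_pmf_finite) simp

lemma E_cong: "(\<And>s c. c \<in> {- 1, 0, 1} \<Longrightarrow> F s c = G s c) \<Longrightarrow> E f l F = E f l G"
  unfolding E_def by (intro Bochner_Integration.integral_cong refl) (use last_carry_range in blast)

lemma E_add: "E f l (\<lambda>s c. F s c + G s c) = E f l F + E f l G"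
  by (simp add: E_def)

lemma E_diff: "E f l (\<lambda>s c. F s c - G s c) = E f l F - E f l G"
  by (simp add: E_def)

lemma E_mult: "E f l (\<lambda>s c. k * F s c) = k * E f l F" for F :: "real \<Rightarrow> int \<Rightarrow> 'b::{real_normed_field, banach, second_countable_topology}"
  by (simp add: E_def)

lemma E_const: "E f l (\<lambda>s c. k) = k"
  by (simp add: E_def)

lemma norm_E_le: "(\<And>s c. c \<in> {- 1, 0, 1} \<Longrightarrow> norm (F s c) \<le> B) \<Longrightarrow> norm (E f l F) \<le> B"
proof -
  assume F: "\<And>s c. c \<in> {- 1, 0, 1} \<Longrightarrow> norm (F s c) \<le> B"
  have "norm (E f l F) \<le> measure_pmf.expectation (rs l) (\<lambda>\<omega>. B)"
    unfolding E_def
    by (intro order_trans[OF integral_norm_bound] integral_mono integrable_rs F last_carry_range)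
  then show ?thesis by simp
qed

definition bound :: "(int \<Rightarrow> real) \<Rightarrow> real" where
  "bound F = \<bar>F 1\<bar> + \<bar>F (- 1)\<bar> + \<bar>F 0\<bar>"

lemma bound: "c \<in> {- 1, 0, 1} \<Longrightarrow> \<bar>F c\<bar> \<le> bound F"
  by (auto simp: bound_def)

section \<open>Moments of the partial sums of a centred function\<close>

context
  fixes f :: "int \<Rightarrow> real"
  assumes centered: "stationary f = 0"
begin

abbreviation "g \<equiv> poisson f"

definition sq :: "int \<Rightarrow> real" where "sq c = (f c)\<^sup>2 + 2 * f c * g c"

abbreviation "w \<equiv> poisson sq"

abbreviation "v \<equiv> stationary sq"

lemma transfer_f_g: "c \<in> {- 1, 0, 1} \<Longrightarrow> transfer (\<lambda>c. f c + g c) c = g c"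
  unfolding transfer_poisson centered by simp

text \<open>The constant expectation is 0 because the start is the empty sum and carry 0, where
  \<open>g\<close> vanishes.\<close>

lemma E_martingale: "E f l (\<lambda>s c. s + g c) = 0"
proof (induction l)
  case (Suc l)
  have "E f (Suc l) (\<lambda>s c. s + g c) = E f l (\<lambda>s c. transfer (\<lambda>c. s + (f c + g c)) c)"
    by (simp add: E_Suc add.assoc)
  also have "\<dots> = E f l (\<lambda>s c. s + g c)"
  proof (rule E_cong)
    fix s c assume c: "c \<in> {- 1, 0, 1 :: int}"
    have "transfer (\<lambda>c. s + (f c + g c)) c = s + transfer (\<lambda>c. f c + g c) c" by simp
    then show "transfer (\<lambda>c. s + (f c + g c)) c = s + g c" unfolding transfer_f_g[OF c] .
  qed
  finally show ?case using Suc by simp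
qed (simp add: E_0)

lemma E_carry_sum_bounded: "\<bar>E f l (\<lambda>s c. s)\<bar> \<le> bound g"
proof -
  have "E f l (\<lambda>s c. s) = - E f l (\<lambda>s c. g c)"
    using E_martingale[of l] by (simp add: E_add)
  then show ?thesis using norm_E_le[of "\<lambda>s c. g c" "bound g" f l] bound by simp
qed

lemma E_square_martingale: "E f l (\<lambda>s c. s\<^sup>2 + 2 * s * g c + w c) = l * stationary sq"
proof (induction l)
  case (Suc l)
  \<comment> \<open>Expanding at \<open>s + f c\<close> leaves
    \<open>(f c)\<^sup>2 + 2 * f c * g c\<close> besides the terms with \<open>s\<close>; this is
    the origin of \<open>sq\<close>.\<close>
  have "E f (Suc l) (\<lambda>s c. s\<^sup>2 + 2 * s * g c + w c)
      = E f l (\<lambda>s c. transfer (\<lambda>c. s\<^sup>2 + 2 * s * (f c + g c) + (sq c + w c)) c)"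
    unfolding E_Suc by (simp add: sq_def power2_eq_square algebra_simps)
  also have "\<dots> = E f l (\<lambda>s c. (s\<^sup>2 + 2 * s * g c + w c) + stationary sq)"
  proof (rule E_cong)
    fix s c assume c: "c \<in> {- 1, 0, 1 :: int}"
    have "transfer (\<lambda>c. s\<^sup>2 + 2 * s * (f c + g c) + (sq c + w c)) c
      = s\<^sup>2 + 2 * s * transfer (\<lambda>c. f c + g c) c + transfer (\<lambda>c. sq c + w c) c"
      by simp
    then show "transfer (\<lambda>c. s\<^sup>2 + 2 * s * (f c + g c) + (sq c + w c)) c
      = (s\<^sup>2 + 2 * s * g c + w c) + stationary sq"
      unfolding transfer_f_g[OF c] transfer_poisson[OF c] by simp
  qed
  also have "\<dots> = l * stationary sq + stationary sq"
    by (subst E_add) (simp only: Suc.IH E_const)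
  finally show ?case by (simp add: algebra_simps)
qed (simp add: E_0)

text \<open>The carry forgets its past at rate \<open>1 / Q\<close>, so the mixed moment obeys a
  contracting recursion driven by bounded terms; Cauchy--Schwarz would only give order sqrt
  l.\<close>

lemma E_times_carry_bounded: "\<exists>B. \<forall>l. \<bar>E f l (\<lambda>s c. s * c)\<bar> \<le> B"
proof -
  define r where "r c = transfer (\<lambda>c. f c * c) c" for c
  have eq: "E f (Suc l) (\<lambda>s c. s * c) = \<alpha> * E f l (\<lambda>s c. s) + (1 / Q) * E f l (\<lambda>s c. s * c) + E f l (\<lambda>s c. r c)" for l
  proof -
    have "E f (Suc l) (\<lambda>s c. s * c) = E f l (\<lambda>s c. \<alpha> * s + (1 / Q) * (s * c) + r c)"
      unfolding E_Suc
    proof (rule E_cong)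
      fix s c assume c: "c \<in> {- 1, 0, 1 :: int}"
      have "transfer (\<lambda>c. (s + f c) * c) c = s * transfer (\<lambda>c. real_of_int c) c + r c"
        by (simp add: distrib_right r_def)
      also have "transfer (\<lambda>c. real_of_int c) c = \<alpha> + c / Q"
        by (simp add: transfer_eq[OF c] lin_def quad_def)
      finally show "transfer (\<lambda>c. (s + f c) * c) c = \<alpha> * s + (1 / Q) * (s * c) + r c"
        by (simp add: field_simps)
    qed
    then show ?thesis by (simp only: E_add E_mult)
  qed
  have r: "\<bar>E f l (\<lambda>s c. r c)\<bar> \<le> bound r" for l
    using norm_E_le[of "\<lambda>s c. r c" "bound r" f l] bound by simp
  have al: "\<bar>\<alpha> * E f l (\<lambda>s c. s)\<bar> \<le> \<bar>\<alpha>\<bar> * bound g" for l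
    by (simp add: abs_mult E_carry_sum_bounded mult_left_mono)
  have abs: "\<bar>(1 / Q) * x\<bar> = (1 / Q) * \<bar>x\<bar>" for x using QD by (simp add: abs_mult)
  have "\<bar>E f (Suc l) (\<lambda>s c. s * c)\<bar> \<le> (1 / Q) * \<bar>E f l (\<lambda>s c. s * c)\<bar> + (\<bar>\<alpha>\<bar> * bound g + bound r)" for l
    using al[of l] r[of l] unfolding eq abs[symmetric] by linarith
  from contraction_bounded[of "\<lambda>l. \<bar>E f l (\<lambda>s c. s * c)\<bar>", OF this] show ?thesis
    using QD by auto
qed

text \<open>The contraction rate is now \<open>1 / Q\<^sup>2\<close>. By triangularity the mixed
  moment with \<open>c\<close> enters as a bounded inhomogeneity, which is why it is treated
  before.\<close>

lemma E_times_carry_square_bounded: "\<exists>B. \<forall>l. \<bar>E f l (\<lambda>s c. s * (real_of_int c)\<^sup>2)\<bar> \<le> B"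
proof -
  define r where "r c = transfer (\<lambda>c. f c * (real_of_int c)\<^sup>2) c" for c
  obtain B where B: "\<And>l. \<bar>E f l (\<lambda>s c. s * c)\<bar> \<le> B" using E_times_carry_bounded by blast
  have eq: "E f (Suc l) (\<lambda>s c. s * (real_of_int c)\<^sup>2) = \<beta> * E f l (\<lambda>s c. s) + \<gamma> * E f l (\<lambda>s c. s * c)
      + (1 / Q\<^sup>2) * E f l (\<lambda>s c. s * (real_of_int c)\<^sup>2) + E f l (\<lambda>s c. r c)" for l
  proof -
    have "E f (Suc l) (\<lambda>s c. s * (real_of_int c)\<^sup>2) =
      E f l (\<lambda>s c. \<beta> * s + \<gamma> * (s * c) + (1 / Q\<^sup>2) * (s * (real_of_int c)\<^sup>2) + r c)"
      unfolding E_Suc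
    proof (rule E_cong)
      fix s c assume c: "c \<in> {- 1, 0, 1 :: int}"
      have "transfer (\<lambda>c. (s + f c) * (real_of_int c)\<^sup>2) c = s * transfer (\<lambda>c. (real_of_int c)\<^sup>2) c + r c"
        by (simp add: distrib_right r_def)
      also have "transfer (\<lambda>c. (real_of_int c)\<^sup>2) c = \<beta> + \<gamma> * c + (real_of_int c)\<^sup>2 / Q\<^sup>2"
        by (simp add: transfer_eq[OF c] lin_def quad_def)
      finally show "transfer (\<lambda>c. (s + f c) * (real_of_int c)\<^sup>2) c
        = \<beta> * s + \<gamma> * (s * c) + (1 / Q\<^sup>2) * (s * (real_of_int c)\<^sup>2) + r c"
        by (simp add: field_simps)
    qed
    then show ?thesis by (simp only: E_add E_mult)
  qed
  have r: "\<bar>E f l (\<lambda>s c. r c)\<bar> \<le> bound r" for l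
    using norm_E_le[of "\<lambda>s c. r c" "bound r" f l] bound by simp
  have be: "\<bar>\<beta> * E f l (\<lambda>s c. s)\<bar> \<le> \<bar>\<beta>\<bar> * bound g" for l
    by (simp add: abs_mult E_carry_sum_bounded mult_left_mono)
  have ga: "\<bar>\<gamma> * E f l (\<lambda>s c. s * c)\<bar> \<le> \<bar>\<gamma>\<bar> * B" for l
    by (simp add: abs_mult B mult_left_mono)
  have abs: "\<bar>(1 / Q\<^sup>2) * x\<bar> = (1 / Q\<^sup>2) * \<bar>x\<bar>" for x by (simp add: abs_mult)
  have "\<bar>E f (Suc l) (\<lambda>s c. s * (real_of_int c)\<^sup>2)\<bar> \<le>
      (1 / Q\<^sup>2) * \<bar>E f l (\<lambda>s c. s * (real_of_int c)\<^sup>2)\<bar> + (\<bar>\<beta>\<bar> * bound g + \<bar>\<gamma>\<bar> * B + bound r)" for l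
    using be[of l] ga[of l] r[of l] unfolding eq abs[symmetric] by linarith
  from contraction_bounded[of "\<lambda>l. \<bar>E f l (\<lambda>s c. s * (real_of_int c)\<^sup>2)\<bar>", OF this] show ?thesis
    using QD power_strict_mono[of 1 Q 2] by auto
qed

text \<open>Writing \<open>g\<close> in powers of the carry turns the cross term of the martingale
  into the two bounded mixed moments.\<close>

lemma E_square_bounded: "\<exists>B. \<forall>l. \<bar>E f l (\<lambda>s c. s\<^sup>2) - l * stationary sq\<bar> \<le> B"
proof -
  obtain B C where B: "\<And>l. \<bar>E f l (\<lambda>s c. s * c)\<bar> \<le> B"
    and C: "\<And>l. \<bar>E f l (\<lambda>s c. s * (real_of_int c)\<^sup>2)\<bar> \<le> C"
    using E_times_carry_bounded E_times_carry_square_bounded by metis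
  have "\<bar>E f l (\<lambda>s c. s\<^sup>2) - l * stationary sq\<bar> \<le> \<bar>2 * poisson1 f\<bar> * B + \<bar>2 * poisson2 f\<bar> * C + bound w" for l
  proof -
    have "l * stationary sq = E f l (\<lambda>s c. s\<^sup>2 + (2 * poisson1 f) * (s * c)
       + (2 * poisson2 f) * (s * (real_of_int c)\<^sup>2) + w c)"
      unfolding E_square_martingale[symmetric] by (simp add: poisson_def[of f] algebra_simps)
    also have "\<dots> = E f l (\<lambda>s c. s\<^sup>2) + (2 * poisson1 f) * E f l (\<lambda>s c. s * c)
       + (2 * poisson2 f) * E f l (\<lambda>s c. s * (real_of_int c)\<^sup>2) + E f l (\<lambda>s c. w c)"
      by (simp only: E_add E_mult)
    finally have "E f l (\<lambda>s c. s\<^sup>2) - l * stationary sq = - ((2 * poisson1 f) * E f l (\<lambda>s c. s * c)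
       + (2 * poisson2 f) * E f l (\<lambda>s c. s * (real_of_int c)\<^sup>2) + E f l (\<lambda>s c. w c))" by linarith
    moreover have "\<bar>E f l (\<lambda>s c. w c)\<bar> \<le> bound w"
      using norm_E_le[of "\<lambda>s c. w c" "bound w" f l] bound by simp
    moreover have "\<bar>(2 * poisson1 f) * E f l (\<lambda>s c. s * c)\<bar> \<le> \<bar>2 * poisson1 f\<bar> * B"
      unfolding abs_mult[of "2 * poisson1 f"] by (intro mult_left_mono B) simp
    moreover have "\<bar>(2 * poisson2 f) * E f l (\<lambda>s c. s * (real_of_int c)\<^sup>2)\<bar> \<le> \<bar>2 * poisson2 f\<bar> * C"
      unfolding abs_mult[of "2 * poisson2 f"] by (intro mult_left_mono C) simp
    ultimately show ?thesis by linarith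
  qed
  then show ?thesis by blast
qed

text \<open>A negative value would make the second moment of the sum negative for large
  \<open>l\<close>. The sign is needed to keep the approximate eigenvalue at most 1.\<close>

lemma stationary_sq_nonneg: "0 \<le> stationary sq"
proof (rule ccontr)
  assume neg: "\<not> 0 \<le> stationary sq"
  obtain B where B: "\<And>l. \<bar>E f l (\<lambda>s c. s\<^sup>2) - l * stationary sq\<bar> \<le> B"
    using E_square_bounded by blast
  obtain l :: nat where "real l * (- stationary sq) > B"
    using reals_Archimedean3[of "- stationary sq"] neg by (metis not_le neg_0_less_iff_less)
  moreover have "0 \<le> E f l (\<lambda>s c. s\<^sup>2)" by (simp add: E_def)
  ultimately show False using B[of l] by (simp add: abs_le_iff)
qed

section \<open>Characteristic function by perturbation of the eigenvalue 1\<close>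

lemma transfer_of_real: "transfer (\<lambda>c. complex_of_real (F c)) c = of_real (transfer F c)"
  by simp

lemma transfer_correction:
  assumes c: "c \<in> {- 1, 0, 1}"
  shows "transfer (\<lambda>c. correction \<theta> (f c + g c) (sq c + w c)) c = correction \<theta> (g c) (w c + v)"
proof -
  have "transfer (\<lambda>c. correction \<theta> (f c + g c) (sq c + w c)) c =
     1 + (\<i> * of_real \<theta>) * transfer (\<lambda>c. complex_of_real (f c + g c)) c
     - of_real (\<theta>\<^sup>2 / 2) * transfer (\<lambda>c. complex_of_real (sq c + w c)) c"
    unfolding correction_def
    by (simp add: algebra_simps)
  then show ?thesis
    unfolding transfer_of_real transfer_poisson[OF c] centered
    by (simp add: correction_def)
qed

text \<open>Both terms are compared with \<open>correction \<theta> (g c) (w c + v)\<close>: the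
  first through \<open>cis_correction\<close> under the average and the two Poisson equations, the
  second through \<open>exp_correction\<close>.\<close>

lemma transfer_cis:
  assumes "\<bar>\<theta>\<bar> \<le> 1" and c: "c \<in> {- 1, 0, 1}"
  shows "norm (transfer (\<lambda>c. cis (\<theta> * f c) * correction \<theta> (g c) (w c)) c
       - of_real (exp (- (\<theta>\<^sup>2 * v / 2))) * correction \<theta> (g c) (w c))
    \<le> \<bar>\<theta>\<bar>^3 * (bound (\<lambda>c. expansion_const1 (f c) (g c) (w c)) + bound (\<lambda>c. expansion_const2 v (g c) (w c)))"
proof -
  have "norm (transfer (\<lambda>c. cis (\<theta> * f c) * correction \<theta> (g c) (w c)
        - correction \<theta> (f c + g c) (sq c + w c)) c)
      \<le> \<bar>\<theta>\<bar>^3 * bound (\<lambda>c. expansion_const1 (f c) (g c) (w c))"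
  proof (rule norm_transfer_le)
    fix c' assume c': "c' \<in> {- 1, 0, 1 :: int}"
    have "norm (cis (\<theta> * f c') * correction \<theta> (g c') (w c')
        - correction \<theta> (f c' + g c') (sq c' + w c')) \<le> \<bar>\<theta>\<bar>^3 * expansion_const1 (f c') (g c') (w c')"
      using cis_correction[OF assms(1), of "f c'" "g c'" "w c'"] by (simp add: sq_def)
    also have "\<dots> \<le> \<bar>\<theta>\<bar>^3 * bound (\<lambda>c. expansion_const1 (f c) (g c) (w c))"
      using bound[OF c', of "\<lambda>c. expansion_const1 (f c) (g c) (w c)"] by (intro mult_left_mono) auto
    finally show "norm (cis (\<theta> * f c') * correction \<theta> (g c') (w c')
        - correction \<theta> (f c' + g c') (sq c' + w c')) \<le> \<bar>\<theta>\<bar>^3 * bound (\<lambda>c. expansion_const1 (f c) (g c) (w c))" .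
  qed
  then have 1: "norm (transfer (\<lambda>c. cis (\<theta> * f c) * correction \<theta> (g c) (w c)) c
        - correction \<theta> (g c) (w c + v)) \<le> \<bar>\<theta>\<bar>^3 * bound (\<lambda>c. expansion_const1 (f c) (g c) (w c))"
    by (subst (asm) Bochner_Integration.integral_diff) (simp_all only: integrable_carry_kernel transfer_correction[OF c])
  have "norm (of_real (exp (- (\<theta>\<^sup>2 * v / 2))) * correction \<theta> (g c) (w c) - correction \<theta> (g c) (w c + v))
    \<le> \<bar>\<theta>\<bar>^3 * expansion_const2 v (g c) (w c)"
    by (rule exp_correction[OF assms(1) stationary_sq_nonneg])
  also have "\<dots> \<le> \<bar>\<theta>\<bar>^3 * bound (\<lambda>c. expansion_const2 v (g c) (w c))"
    using bound[OF c, of "\<lambda>c. expansion_const2 v (g c) (w c)"] by (intro mult_left_mono) auto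
  finally show ?thesis
    using 1 norm_triangle_le_diff by (simp add: distrib_left norm_diff_triangle_le norm_minus_commute)
qed

lemma characteristic_function_tendsto:
  "(\<lambda>l. E f l (\<lambda>s c. cis (s / sqrt l))) \<longlonglongrightarrow> exp (- v / 2)"
proof -
  define K where "K = bound (\<lambda>c. expansion_const1 (f c) (g c) (w c)) + bound (\<lambda>c. expansion_const2 v (g c) (w c))"
  define G where "G = bound g + bound w"
  have main: "norm (E f l (\<lambda>s c. cis (s / sqrt l)) - exp (- v / 2)) \<le> (K + G) / sqrt l" if l: "l \<ge> 1" for l :: nat
  proof -
    define \<theta> where "\<theta> = 1 / sqrt l"
    have \<theta>: "0 < \<theta>" "\<bar>\<theta>\<bar> \<le> 1" using l by (auto simp: \<theta>_def)
    define u where "u c = correction \<theta> (g c) (w c)" for c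
    define \<rho> where "\<rho> = exp (- (\<theta>\<^sup>2 * v / 2))"
    have \<rho>: "0 \<le> \<rho>" "\<rho> \<le> 1"
      using stationary_sq_nonneg by (auto simp: \<rho>_def)
    \<comment> \<open>Weighting by the approximate eigenfunction makes each step a multiplication by
      \<open>\<rho>\<close> up to an error of order \<theta>^3.\<close>
    define V where "V n = E f n (\<lambda>s c. cis (\<theta> * s) * u c)" for n
    have V_Suc: "norm (V (Suc n) - \<rho> * V n) \<le> \<theta>^3 * K" for n
    proof -
      have "V (Suc n) - \<rho> * V n =
         E f n (\<lambda>s c. cis (\<theta> * s) * (transfer (\<lambda>c. cis (\<theta> * f c) * u c) c - \<rho> * u c))"
      proof -
        have "V (Suc n) = E f n (\<lambda>s c. cis (\<theta> * s) * transfer (\<lambda>c. cis (\<theta> * f c) * u c) c)"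
          unfolding V_def E_Suc
          by (simp add: distrib_left cis_mult[symmetric] mult.assoc)
        moreover have "\<rho> * V n = E f n (\<lambda>s c. cis (\<theta> * s) * (\<rho> * u c))"
          unfolding V_def E_mult[symmetric] by (simp add: mult_ac)
        ultimately show ?thesis by (simp only: E_diff right_diff_distrib)
      qed
      also have "norm \<dots> \<le> \<theta>^3 * K"
      proof (rule norm_E_le)
        fix s and c assume c: "c \<in> {- 1, 0, 1 :: int}"
        show "norm (cis (\<theta> * s) * (transfer (\<lambda>c. cis (\<theta> * f c) * u c) c - \<rho> * u c)) \<le> \<theta>^3 * K"
          using transfer_cis[OF \<theta>(2) c] \<theta>(1) by (simp add: norm_mult u_def \<rho>_def K_def)
      qed
      finally show ?thesis .
    qed
    have V: "norm (V n - \<rho>^n) \<le> n * (\<theta>^3 * K)" for n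
    proof (induction n)
      case 0
      \<comment> \<open>\<open>V 0 = 1\<close>, because \<open>g\<close> and \<open>w\<close> vanish
        at the initial carry 0.\<close>
      then show ?case by (simp add: V_def E_0 u_def correction_def)
    next
      case (Suc n)
      have "norm (\<rho> * (V n - \<rho>^n)) \<le> 1 * (n * (\<theta>^3 * K))"
        unfolding norm_mult using \<rho> Suc by (intro mult_mono) auto
      moreover have "V (Suc n) - \<rho>^Suc n = (V (Suc n) - \<rho> * V n) + \<rho> * (V n - \<rho>^n)"
        by (simp add: algebra_simps)
      ultimately show ?case
        using norm_triangle_le[OF add_mono[OF V_Suc[of n] \<open>norm (\<rho> * (V n - \<rho>^n)) \<le> _\<close>]]
        by (simp add: algebra_simps)
    qed
    have "\<rho>^l = exp (- v / 2)"
      using l by (simp add: \<rho>_def exp_of_nat_mult[symmetric] \<theta>_def power_divide)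
    then have 1: "norm (V l - exp (- v / 2)) \<le> l * (\<theta>^3 * K)"
      using V[of l] by (metis of_real_power)
    have "l * \<theta>^3 = \<theta>" using l by (simp add: \<theta>_def power3_eq_cube field_simps)
    then have lK: "l * (\<theta>^3 * K) = \<theta> * K" by (metis mult.assoc)
    \<comment> \<open>Removing the weight at the end costs only O(\<theta>), as \<open>u\<close>
      differs from 1 by that much.\<close>
    have "E f l (\<lambda>s c. cis (\<theta> * s)) - V l = E f l (\<lambda>s c. cis (\<theta> * s) * (1 - u c))"
      unfolding V_def by (simp only: E_diff right_diff_distrib mult_1_right)
    also have "norm \<dots> \<le> \<theta> * G"
    proof (rule norm_E_le)
      fix s and c assume c: "c \<in> {- 1, 0, 1 :: int}"
      have "norm (1 - u c) \<le> \<theta> * (\<bar>g c\<bar> + \<bar>w c\<bar>)"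
        using norm_correction_minus_1_le[OF \<theta>(2)] \<theta>(1) by (simp add: u_def norm_minus_commute)
      also have "\<dots> \<le> \<theta> * G"
        unfolding G_def using \<theta>(1) bound[OF c] by (intro mult_left_mono add_mono) auto
      finally show "norm (cis (\<theta> * s) * (1 - u c)) \<le> \<theta> * G" by (simp add: norm_mult)
    qed
    finally have 2: "norm (E f l (\<lambda>s c. cis (\<theta> * s)) - V l) \<le> \<theta> * G" .
    have "norm (E f l (\<lambda>s c. cis (\<theta> * s)) - exp (- v / 2)) \<le> \<theta> * G + \<theta> * K"
      using norm_diff_triangle_le[OF 2 1] unfolding lK .
    then show ?thesis by (simp add: \<theta>_def add_divide_distrib add.commute)
  qed
  have "(\<lambda>l. (K + G) / sqrt (real l)) \<longlonglongrightarrow> 0" by real_asymp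
  then have "(\<lambda>l. E f l (\<lambda>s c. cis (s / sqrt l)) - exp (- v / 2)) \<longlonglongrightarrow> 0"
    by (rule Lim_null_comparison[rotated]) (rule eventually_mono[OF eventually_ge_at_top[of "1::nat"] main])
  then show ?thesis by (simp add: LIM_zero_iff)
qed

end

end

section \<open>The constants\<close>

definition mean1 :: "real \<Rightarrow> real \<Rightarrow> real" where
  "mean1 Q D = (Q + D - 1)^2 / (2 * (Q - 1)^2)"
definition mean_m1 :: "real \<Rightarrow> real \<Rightarrow> real" where
  "mean_m1 Q D = D^2 / (2 * (Q - 1)^2)"
definition var1 :: "real \<Rightarrow> real \<Rightarrow> real" where
  "var1 Q D = (Q + D - 1)^2 * (Q^4 - 2*Q^3*D - Q^2*D^2 - 4*Q*D^2 - 2*Q^2 - D^2 + 2*D + 1)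
                / (4 * (Q - 1)^5 * (Q + 1))"
definition var_m1 :: "real \<Rightarrow> real \<Rightarrow> real" where
  "var_m1 Q D = D^2 * (2*Q^4 - Q^2*D^2 - 4*Q^3 - 6*Q^2*D - 4*Q*D^2 + 4*Q^2 + 6*Q*D
                        - D^2 - 4*Q + 2)
                / (4 * (Q - 1)^5 * (Q + 1))"
definition cov :: "real \<Rightarrow> real \<Rightarrow> real" where
  "cov Q D = - (D * (Q + D - 1) * (Q^3*D + Q^2*D^2 - Q^3 + 3*Q^2*D + 4*Q*D^2 + 2*Q^2 - 3*Q*D
                        + D^2 - Q - D))
                / (4 * (Q - 1)^5 * (Q + 1))"

text \<open>In terms of \<open>a = q + d - 1\<close> and \<open>k = - d\<close>, the numerators of the variances and of the
  determinant of the covariance matrix have only nonnegative coefficients.\<close>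

lemma var1_pos:
  assumes "Q + D - 1 > 0" "D \<le> 0"
  shows "var1 Q D > 0"
proof -
  define a k where "a = Q + D - 1" and "k = - D"
  have QD: "Q = a + k + 1" "D = - k" and ak: "a > 0" "k \<ge> 0"
    using assms by (auto simp: a_def k_def)
  have "Q^4 - 2*Q^3*D - Q^2*D^2 - 4*Q*D^2 - 2*Q^2 - D^2 + 2*D + 1
    = a^4 + 4 * a^3 + 6 * a^3 * k + 4 * a^2 + 18 * a^2 * k + 11 * a^2 * k^2 + 14 * a * k
       + 18 * a * k^2 + 8 * a * k^3 + 4 * k^2 + 4 * k^3 + 2 * k^4"
    unfolding QD by algebra
  also have "\<dots> > 0"
    by (intro add_pos_nonneg zero_less_power add_nonneg_nonneg mult_nonneg_nonneg zero_le_power)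
       (use ak in simp_all)
  finally show ?thesis
    using assms by (simp add: var1_def zero_less_divide_iff zero_less_mult_iff)
qed

text \<open>The polynomial is the one for \<open>var1\<close> with \<open>a\<close> and
  \<open>k\<close> exchanged: negating all digits replaces \<open>d\<close> by
  \<open>- q - d + 1\<close> and swaps the carries 1 and -1.\<close>

lemma var_m1_pos:
  assumes "Q + D - 1 \<ge> 0" "D < 0"
  shows "var_m1 Q D > 0"
proof -
  define a k where "a = Q + D - 1" and "k = - D"
  have QD: "Q = a + k + 1" "D = - k" and ak: "a \<ge> 0" "k > 0"
    using assms by (auto simp: a_def k_def)
  have "2*Q^4 - Q^2*D^2 - 4*Q^3 - 6*Q^2*D - 4*Q*D^2 + 4*Q^2 + 6*Q*D - D^2 - 4*Q + 2
    = k^4 + 4 * k^3 + 6 * a * k^3 + 4 * k^2 + 18 * a * k^2 + 11 * a^2 * k^2 + 14 * a * k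
       + 18 * a^2 * k + 8 * a^3 * k + 4 * a^2 + 4 * a^3 + 2 * a^4"
    unfolding QD by algebra
  also have "\<dots> > 0"
    by (intro add_pos_nonneg zero_less_power add_nonneg_nonneg mult_nonneg_nonneg zero_le_power)
       (use ak in simp_all)
  finally show ?thesis
    using assms by (simp add: var_m1_def zero_less_divide_iff zero_less_mult_iff)
qed

text \<open>The factor \<open>(a * k / m)\<^sup>2\<close> splits off the determinant. It vanishes
  for \<open>a = 0\<close> and for \<open>k = 0\<close>, hence the two strict inequalities.\<close>

lemma det_cov_pos:
  assumes "Q + D - 1 > 0" "D < 0"
  shows "var1 Q D * var_m1 Q D - (cov Q D)\<^sup>2 > 0"
proof -
  define a k where "a = Q + D - 1" and "k = - D"
  have QD: "Q = a + k + 1" "D = - k" and ak: "a > 0" "k > 0"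
    using assms by (auto simp: a_def k_def)
  define n1 where "n1 = Q^4 - 2*Q^3*D - Q^2*D^2 - 4*Q*D^2 - 2*Q^2 - D^2 + 2*D + 1"
  define n2 where "n2 = 2*Q^4 - Q^2*D^2 - 4*Q^3 - 6*Q^2*D - 4*Q*D^2 + 4*Q^2 + 6*Q*D - D^2 - 4*Q + 2"
  define n3 where "n3 = Q^3*D + Q^2*D^2 - Q^3 + 3*Q^2*D + 4*Q*D^2 + 2*Q^2 - 3*Q*D + D^2 - Q - D"
  define m where "m = 4 * (Q - 1)^5 * (Q + 1)"
  have "n1 * n2 - n3\<^sup>2
    = 2 * a^8 + 12 * a^7 + 20 * a^7 * k + 27 * a^6 + 108 * a^6 * k + 80 * a^6 * k^2 + 30 * a^5
       + 222 * a^5 * k + 372 * a^5 * k^2 + 172 * a^5 * k^3 + 15 * a^4 + 222 * a^4 * k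
       + 645 * a^4 * k^2 + 660 * a^4 * k^3 + 220 * a^4 * k^4 + 96 * a^3 * k + 516 * a^3 * k^2
       + 900 * a^3 * k^3 + 660 * a^3 * k^4 + 172 * a^3 * k^5 + 162 * a^2 * k^2
       + 516 * a^2 * k^3 + 645 * a^2 * k^4 + 372 * a^2 * k^5 + 80 * a^2 * k^6 + 96 * a * k^3
       + 222 * a * k^4 + 222 * a * k^5 + 108 * a * k^6 + 20 * a * k^7 + 15 * k^4 + 30 * k^5
       + 27 * k^6 + 12 * k^7 + 2 * k^8"
    unfolding n1_def n2_def n3_def QD by algebra
  also have "\<dots> > 0"
    by (intro add_pos_pos zero_less_power mult_pos_pos) (use ak in simp_all)
  finally have pos: "n1 * n2 - n3\<^sup>2 > 0" .
  have "m > 0" using ak by (simp add: m_def QD)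
  have v1: "var1 Q D = a\<^sup>2 * n1 / m" and v2: "var_m1 Q D = k\<^sup>2 * n2 / m" and c: "cov Q D = k * a * n3 / m"
    by (simp_all add: var1_def var_m1_def cov_def n1_def n2_def n3_def m_def a_def k_def)
  have "var1 Q D * var_m1 Q D - (cov Q D)\<^sup>2 = (a * k / m)\<^sup>2 * (n1 * n2 - n3\<^sup>2)"
    unfolding v1 v2 c by (simp add: power_divide power_mult_distrib algebra_simps power2_eq_square)
       (simp add: diff_divide_distrib)
  also have "\<dots> > 0" using pos ak \<open>m > 0\<close> by simp
  finally show ?thesis .
qed

text \<open>The formula for the asymptotic variance of \<open>x M + y N\<close>, multiplied by \<open>8 (q - 1)\<^sup>6 (q + 1)\<close>.\<close>

lemma variance_identity:
  fixes Q D x y :: real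
  shows "(x * (Q + D - 1)\<^sup>2 + y * D\<^sup>2)\<^sup>2 * (Q + 1) * (2 * (Q - 1)\<^sup>2 - (Q + D - 1)\<^sup>2 - D\<^sup>2)
    + (Q + D - 1)\<^sup>2 * (2 * (Q - 1)\<^sup>2 * x - (x * (Q + D - 1)\<^sup>2 + y * D\<^sup>2)) *
      ((2 * (Q - 1)\<^sup>2 * x - (x * (Q + D - 1)\<^sup>2 + y * D\<^sup>2)) * (Q + 1)
       + 2 * ((x - y) * (Q - 1) * (Q + 1) + (x + y) * (Q * (Q + 2 * D - 1) + (Q - 1))))
    + D\<^sup>2 * (2 * (Q - 1)\<^sup>2 * y - (x * (Q + D - 1)\<^sup>2 + y * D\<^sup>2)) *
      ((2 * (Q - 1)\<^sup>2 * y - (x * (Q + D - 1)\<^sup>2 + y * D\<^sup>2)) * (Q + 1)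
       + 2 * (- (x - y) * (Q - 1) * (Q + 1) - (x + y) * (Q * (Q + 2 * D - 1) - (Q - 1))))
    = 2 * (Q - 1) * ((Q + D - 1)\<^sup>2 * (Q^4 - 2*Q^3*D - Q^2*D^2 - 4*Q*D^2 - 2*Q^2 - D^2 + 2*D + 1) * x\<^sup>2
      - 2 * (D * (Q + D - 1) * (Q^3*D + Q^2*D^2 - Q^3 + 3*Q^2*D + 4*Q*D^2 + 2*Q^2 - 3*Q*D + D^2 - Q - D)) * x * y
      + D\<^sup>2 * (2*Q^4 - Q^2*D^2 - 4*Q^3 - 6*Q^2*D - 4*Q*D^2 + 4*Q^2 + 6*Q*D - D^2 - 4*Q + 2) * y\<^sup>2)"
  by algebra

section \<open>Closed forms for the stationary mean and variance\<close>

context addition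
begin

definition weight :: "real \<Rightarrow> real \<Rightarrow> int \<Rightarrow> real" where
  "weight x y c = (if c = 1 then x else if c = - 1 then y else 0) - (x * mean1 Q D + y * mean_m1 Q D)"

lemma Q_neq: "Q - 1 \<noteq> 0" "Q + 1 \<noteq> 0" "Q \<noteq> 0" "Q\<^sup>2 - 1 = (Q - 1) * (Q + 1)"
  using QD by (auto simp: power2_eq_square algebra_simps)

lemma poisson2_eq: "poisson2 F = quad F / ((Q - 1) * (Q + 1))"
  by (simp add: poisson2_def Q_neq)

lemma poisson1_eq: "poisson1 F = lin F / (Q - 1) + quad F * Q * (Q + 2 * D - 1) / ((Q - 1)\<^sup>2 * (Q + 1))"
proof -
  have "quad F + poisson2 F = quad F * Q\<^sup>2 / ((Q - 1) * (Q + 1))"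
    using Q_neq(1-3) unfolding poisson2_eq by (simp add: divide_simps) (simp add: algebra_simps power2_eq_square)
  show ?thesis
    using Q_neq(1-3) unfolding poisson1_def \<gamma>_def \<open>quad F + poisson2 F = _\<close>
    by (simp add: divide_simps) (simp add: algebra_simps power2_eq_square)
qed

text \<open>The coefficients are the stationary probabilities of the carries 0, 1 and -1; this
  identifies \<open>mean1\<close> and \<open>mean_m1\<close> as long-run frequencies.\<close>

lemma stationary_eq:
  "stationary F = F 0 * (1 - mean1 Q D - mean_m1 Q D) + F 1 * mean1 Q D + F (- 1) * mean_m1 Q D"
proof -
  have 2: "quad F + poisson2 F = quad F * Q\<^sup>2 / ((Q - 1) * (Q + 1))"
    using Q_neq(1-3) unfolding poisson2_eq by (simp add: divide_simps) (simp add: algebra_simps power2_eq_square)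
  have 1: "(lin F + poisson1 F) * \<alpha> = lin F * (mean1 Q D - mean_m1 Q D)
      + quad F * (Q + 2 * D - 1)\<^sup>2 / (2 * (Q - 1)\<^sup>2 * (Q + 1))"
    using Q_neq(1-3) unfolding poisson1_eq \<alpha>_def mean1_def mean_m1_def
    by (simp add: divide_simps) (simp add: algebra_simps power2_eq_square)
  have 3: "Q\<^sup>2 / ((Q - 1) * (Q + 1)) * \<beta> + (Q + 2 * D - 1)\<^sup>2 / (2 * (Q - 1)\<^sup>2 * (Q + 1)) = mean1 Q D + mean_m1 Q D"
    using Q_neq(1-3) unfolding \<beta>_def mean1_def mean_m1_def
    by (simp add: divide_simps) (simp add: algebra_simps power2_eq_square)
  have "stationary F = F 0 + lin F * (mean1 Q D - mean_m1 Q D) + quad F *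
     (Q\<^sup>2 / ((Q - 1) * (Q + 1)) * \<beta> + (Q + 2 * D - 1)\<^sup>2 / (2 * (Q - 1)\<^sup>2 * (Q + 1)))"
    unfolding stationary_def 1 2 by (simp add: algebra_simps)
  then show ?thesis
    unfolding 3 by (simp add: lin_def quad_def field_simps)
qed

lemma stationary_weight: "stationary (weight x y) = 0"
  by (simp add: stationary_eq weight_def algebra_simps)

text \<open>Stationary probabilities and weights have denominator \<open>2 * r\<^sup>2\<close>, the
  Poisson solution has \<open>2 * r\<^sup>2 * s\<close>, so \<open>8 * r^6 * s\<close> is a common
  denominator and \<open>variance_identity\<close> evaluates the numerator. The coefficients of the
  form in \<open>x\<close> and \<open>y\<close> give both variances and the covariance at
  once.\<close>

lemma stationary_sq_weight:
  "stationary (sq (weight x y)) = var1 Q D * x\<^sup>2 + 2 * cov Q D * x * y + var_m1 Q D * y\<^sup>2"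
proof -
  define r s a b where "r = Q - 1" and "s = Q + 1" and "a = (Q + D - 1)\<^sup>2" and "b = D\<^sup>2"
  have rs: "r \<noteq> 0" "s \<noteq> 0" using Q_neq by (simp_all add: r_def s_def)
  define n1 where "n1 = Q^4 - 2*Q^3*D - Q^2*D^2 - 4*Q*D^2 - 2*Q^2 - D^2 + 2*D + 1"
  define n2 where "n2 = 2*Q^4 - Q^2*D^2 - 4*Q^3 - 6*Q^2*D - 4*Q*D^2 + 4*Q^2 + 6*Q*D - D^2 - 4*Q + 2"
  define n3 where "n3 = D * (Q + D - 1) * (Q^3*D + Q^2*D^2 - Q^3 + 3*Q^2*D + 4*Q*D^2 + 2*Q^2 - 3*Q*D + D^2 - Q - D)"
  define e where "e = x * a + y * b"
  \<comment> \<open>\<open>u1\<close> and \<open>u2\<close> are the numerators of the Poisson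
    solution at the carries 1 and -1 over \<open>2 * r\<^sup>2 * s\<close>.\<close>
  define u1 where "u1 = (x - y) * r * s + (x + y) * (Q * (Q + 2 * D - 1) + r)"
  define u2 where "u2 = - (x - y) * r * s - (x + y) * (Q * (Q + 2 * D - 1) - r)"
  have quad: "quad (weight x y) = (x + y) / 2" and lin: "lin (weight x y) = (x - y) / 2"
    by (simp_all add: quad_def lin_def weight_def field_simps)
  have p: "poisson (weight x y) 1 = u1 / (2 * r\<^sup>2 * s)" "poisson (weight x y) (- 1) = u2 / (2 * r\<^sup>2 * s)"
    using rs unfolding poisson_def poisson1_eq poisson2_eq quad lin r_def[symmetric] s_def[symmetric] u1_def u2_def
    by (simp_all add: divide_simps) (simp_all add: algebra_simps power2_eq_square)
  have m: "mean1 Q D = a / (2 * r\<^sup>2)" "mean_m1 Q D = b / (2 * r\<^sup>2)"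
    by (simp_all add: mean1_def mean_m1_def a_def b_def r_def)
  have e: "x * mean1 Q D + y * mean_m1 Q D = e / (2 * r\<^sup>2)"
    by (simp add: m e_def add_divide_distrib)
  have w: "weight x y 0 = - e / (2 * r\<^sup>2)" "weight x y 1 = (2 * r\<^sup>2 * x - e) / (2 * r\<^sup>2)"
     "weight x y (- 1) = (2 * r\<^sup>2 * y - e) / (2 * r\<^sup>2)"
    using rs by (simp_all add: weight_def e diff_divide_distrib)
  have "stationary (sq (weight x y)) = (e\<^sup>2 * s * (2 * r\<^sup>2 - a - b)
      + a * (2 * r\<^sup>2 * x - e) * ((2 * r\<^sup>2 * x - e) * s + 2 * u1)
      + b * (2 * r\<^sup>2 * y - e) * ((2 * r\<^sup>2 * y - e) * s + 2 * u2)) / (8 * r^6 * s)"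
    unfolding stationary_eq sq_def[OF stationary_weight] w m p poisson_0
    using rs by (simp add: divide_simps) (simp add: algebra_simps eval_nat_numeral)
  also have "e\<^sup>2 * s * (2 * r\<^sup>2 - a - b)
      + a * (2 * r\<^sup>2 * x - e) * ((2 * r\<^sup>2 * x - e) * s + 2 * u1)
      + b * (2 * r\<^sup>2 * y - e) * ((2 * r\<^sup>2 * y - e) * s + 2 * u2)
      = 2 * r * (a * n1 * x\<^sup>2 - 2 * n3 * x * y + b * n2 * y\<^sup>2)"
    unfolding e_def a_def b_def r_def s_def u1_def u2_def n1_def n2_def n3_def
    by (rule variance_identity)
  also have "\<dots> / (8 * r^6 * s) = a * n1 / (4 * r^5 * s) * x\<^sup>2 + 2 * (- n3 / (4 * r^5 * s)) * x * y + b * n2 / (4 * r^5 * s) * y\<^sup>2"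
    using rs by (simp add: divide_simps) (simp add: algebra_simps eval_nat_numeral)
  also have "\<dots> = var1 Q D * x\<^sup>2 + 2 * cov Q D * x * y + var_m1 Q D * y\<^sup>2"
    unfolding var1_def cov_def var_m1_def a_def b_def r_def s_def n1_def n2_def n3_def by simp
  finally show ?thesis .
qed

end

section \<open>Asymptotics of the numbers of carries\<close>

context addition
begin

lemma num_carries_eq:
  "num_carries q d t l \<omega> = (\<Sum>j = 1..l. if carry q d (fst \<omega>) (snd \<omega>) j = t then 1 else 0)"
  by (simp add: num_carries_def case_prod_unfold flip: sum.inter_filter)

definition tally :: "real \<Rightarrow> real \<Rightarrow> nat \<Rightarrow> (nat \<Rightarrow> int) \<times> (nat \<Rightarrow> int) \<Rightarrow> real" where
  "tally x y l \<omega> = x * carries_M q d l \<omega> + y * carries_N q d l \<omega>"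

lemma carry_sum_weight:
  "carry_sum (weight x y) l \<omega> = tally x y l \<omega> - (x * mean1 Q D + y * mean_m1 Q D) * real l"
proof -
  have "weight x y c = x * (if c = 1 then 1 else 0) + y * (if c = - 1 then 1 else 0)
      - (x * mean1 Q D + y * mean_m1 Q D)" for c
    by (simp add: weight_def)
  then show ?thesis
    by (simp add: tally_def carry_sum_def num_carries_eq case_prod_unfold sum_subtractf sum.distrib sum_distrib_left)
qed

lemma E_weight: "E (weight x y) l (\<lambda>s c. F s) = measure_pmf.expectation (rs l)
   (\<lambda>\<omega>. F (tally x y l \<omega> - (x * mean1 Q D + y * mean_m1 Q D) * real l))"
  by (simp add: E_def carry_sum_weight)

lemma mean_bounded:
  "\<exists>B. \<forall>l. \<bar>measure_pmf.expectation (rs l) (tally x y l) - (x * mean1 Q D + y * mean_m1 Q D) * real l\<bar> \<le> B"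
  using E_carry_sum_bounded[OF stationary_weight[of x y]] unfolding E_weight by auto

text \<open>The deterministic shift between \<open>tally\<close> and \<open>carry_sum\<close> does
  not affect the variance, and the squared mean of \<open>carry_sum\<close> is bounded, so the
  second-moment estimate carries over.\<close>

lemma variance_bounded:
  "\<exists>B. \<forall>l. \<bar>measure_pmf.variance (rs l) (tally x y l)
     - (var1 Q D * x\<^sup>2 + 2 * cov Q D * x * y + var_m1 Q D * y\<^sup>2) * real l\<bar> \<le> B"
proof -
  define v where "v = var1 Q D * x\<^sup>2 + 2 * cov Q D * x * y + var_m1 Q D * y\<^sup>2"
  obtain B where B: "\<And>l. \<bar>E (weight x y) l (\<lambda>s c. s)\<bar> \<le> B"
    using E_carry_sum_bounded[OF stationary_weight] by blast
  obtain C where C: "\<And>l. \<bar>E (weight x y) l (\<lambda>s c. s\<^sup>2) - real l * stationary (sq (weight x y))\<bar> \<le> C"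
    using E_square_bounded[OF stationary_weight] by blast
  have var: "measure_pmf.variance (rs l) (tally x y l)
     = E (weight x y) l (\<lambda>s c. s\<^sup>2) - (E (weight x y) l (\<lambda>s c. s))\<^sup>2" for l
  proof -
    have "carry_sum (weight x y) l = (\<lambda>\<omega>. tally x y l \<omega> - (x * mean1 Q D + y * mean_m1 Q D) * real l)"
      by (simp add: fun_eq_iff carry_sum_weight)
    then have "measure_pmf.variance (rs l) (tally x y l) = measure_pmf.variance (rs l) (carry_sum (weight x y) l)"
      by simp
    then show ?thesis by (simp add: measure_pmf.variance_eq E_def)
  qed
  have "\<bar>measure_pmf.variance (rs l) (tally x y l) - v * real l\<bar> \<le> C + B\<^sup>2" for l
  proof -
    have "(E (weight x y) l (\<lambda>s c. s))\<^sup>2 \<le> B\<^sup>2"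
      using power_mono[OF B, of l 2] by simp
    moreover have "\<bar>E (weight x y) l (\<lambda>s c. s\<^sup>2) - v * real l\<bar> \<le> C"
      using C[of l] by (simp add: v_def stationary_sq_weight mult.commute)
    ultimately show ?thesis
      using zero_le_power2[of "E (weight x y) l (\<lambda>s c. s)"] unfolding var by linarith
  qed
  then show ?thesis unfolding v_def by blast
qed

text \<open>The limit is known for sums centred at \<open>l\<close> times the stationary mean,
  whereas here the exact mean is subtracted. The difference is bounded, so division by sqrt l leaves
  a phase factor tending to 1.\<close>

lemma char_tendsto:
  "(\<lambda>l. measure_pmf.expectation (rs l) (\<lambda>\<omega>. cis ((tally x y l \<omega> - measure_pmf.expectation (rs l) (tally x y l)) / sqrt (real l))))
    \<longlonglongrightarrow> exp (- (var1 Q D * x\<^sup>2 + 2 * cov Q D * x * y + var_m1 Q D * y\<^sup>2) / 2)"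
proof -
  define m where "m l = E (weight x y) l (\<lambda>s c. s)" for l
  obtain B where B: "\<And>l. \<bar>m l\<bar> \<le> B"
    using E_carry_sum_bounded[OF stationary_weight] unfolding m_def by blast
  have "(\<lambda>l. m l / sqrt (real l)) \<longlonglongrightarrow> 0"
  proof (rule Lim_null_comparison)
    show "\<forall>\<^sub>F l in sequentially. norm (m l / sqrt (real l)) \<le> B / sqrt (real l)"
      using B by (auto intro!: always_eventually divide_right_mono)
    show "(\<lambda>l. B / sqrt (real l)) \<longlonglongrightarrow> 0" by real_asymp
  qed
  then have "(\<lambda>l. cis (- (m l / sqrt (real l)))) \<longlonglongrightarrow> cis (- 0)"
    by (intro tendsto_intros)
  from tendsto_mult[OF this characteristic_function_tendsto[OF stationary_weight[of x y]]]
  have "(\<lambda>l. cis (- (m l / sqrt (real l))) * E (weight x y) l (\<lambda>s c. cis (s / sqrt (real l))))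
     \<longlonglongrightarrow> exp (- (var1 Q D * x\<^sup>2 + 2 * cov Q D * x * y + var_m1 Q D * y\<^sup>2) / 2)"
    by (simp add: stationary_sq_weight)
  moreover have "cis (- (m l / sqrt (real l))) * E (weight x y) l (\<lambda>s c. cis (s / sqrt (real l)))
    = measure_pmf.expectation (rs l) (\<lambda>\<omega>. cis ((tally x y l \<omega> - measure_pmf.expectation (rs l) (tally x y l)) / sqrt (real l)))" for l
  proof -
    have "m l = measure_pmf.expectation (rs l) (tally x y l) - (x * mean1 Q D + y * mean_m1 Q D) * real l"
      unfolding m_def E_weight by simp
    then show ?thesis
      unfolding E_mult[symmetric] unfolding cis_mult unfolding E_weight
      by (simp add: diff_divide_distrib)
  qed
  ultimately show ?thesis by simp
qed

lemma bigo_1I: "\<exists>B. \<forall>l. \<bar>F l\<bar> \<le> B \<Longrightarrow> (F :: nat \<Rightarrow> real) \<in> O(\<lambda>_. 1)"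
  by (elim exE, rule bigoI) (auto intro: always_eventually)

lemma tally_M: "tally 1 0 l = carries_M q d l" and tally_N: "tally 0 1 l = carries_N q d l"
  by (simp_all add: tally_def fun_eq_iff)

lemma mean_bigo:
  "(\<lambda>l. measure_pmf.expectation (rs l) (carries_M q d l) - mean1 Q D * real l) \<in> O(\<lambda>_. 1)"
  "(\<lambda>l. measure_pmf.expectation (rs l) (carries_N q d l) - mean_m1 Q D * real l) \<in> O(\<lambda>_. 1)"
  using mean_bounded[of 1 0] mean_bounded[of 0 1] by (simp_all add: tally_M tally_N bigo_1I)

lemma variance_bigo:
  "(\<lambda>l. measure_pmf.variance (rs l) (carries_M q d l) - var1 Q D * real l) \<in> O(\<lambda>_. 1)"
  "(\<lambda>l. measure_pmf.variance (rs l) (carries_N q d l) - var_m1 Q D * real l) \<in> O(\<lambda>_. 1)"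
  using variance_bounded[of 1 0] variance_bounded[of 0 1] by (simp_all add: tally_M tally_N bigo_1I)

lemma covariance_bigo:
  "(\<lambda>l. covariance (rs l) (carries_M q d l) (carries_N q d l) - cov Q D * real l) \<in> O(\<lambda>_. 1)"
proof -
  have "(\<lambda>l. measure_pmf.variance (rs l) (tally 1 1 l) - (var1 Q D + 2 * cov Q D + var_m1 Q D) * real l) \<in> O(\<lambda>_. 1)"
    using variance_bounded[of 1 1] by (simp add: bigo_1I)
  from sum_in_bigo(2)[OF sum_in_bigo(2)[OF this variance_bigo(1)] variance_bigo(2)]
  have "(\<lambda>l. 1 / 2 * (measure_pmf.variance (rs l) (tally 1 1 l) - (var1 Q D + 2 * cov Q D + var_m1 Q D) * real l
     - (measure_pmf.variance (rs l) (carries_M q d l) - var1 Q D * real l)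
     - (measure_pmf.variance (rs l) (carries_N q d l) - var_m1 Q D * real l))) \<in> O(\<lambda>_. 1)"
    by (subst landau_o.big.cmult_in_iff) simp_all
  moreover have "tally 1 1 l = (\<lambda>\<omega>. carries_M q d l \<omega> + carries_N q d l \<omega>)" for l
    by (simp add: tally_def fun_eq_iff)
  ultimately show ?thesis
    by (simp add: covariance_polarization field_simps)
qed

text \<open>At \<open>l = 0\<close> the variance vanishes; for \<open>l \<ge> 1\<close> the bounded
  error is absorbed into the slope. The tightness argument uses the bound in this purely linear
  form.\<close>

lemma variance_linear_bound:
  "\<exists>K. \<forall>l. measure_pmf.variance (rs l) (tally x y l) \<le> K * real l"
proof -
  define v where "v = var1 Q D * x\<^sup>2 + 2 * cov Q D * x * y + var_m1 Q D * y\<^sup>2"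
  obtain B where B: "\<And>l. \<bar>measure_pmf.variance (rs l) (tally x y l) - v * real l\<bar> \<le> B"
    using variance_bounded[of x y] unfolding v_def by blast
  have B0: "0 \<le> B" using B[of 0] by linarith
  have "measure_pmf.variance (rs l) (tally x y l) \<le> (v + B) * real l" for l
  proof (cases "l = 0")
    case True
    moreover have "tally x y 0 = (\<lambda>_. 0)" by (simp add: fun_eq_iff tally_def num_carries_eq)
    ultimately show ?thesis by simp
  next
    case False
    then have "B * 1 \<le> B * real l" using B0 by (intro mult_left_mono) auto
    then show ?thesis using B[of l] by (simp add: distrib_right abs_le_iff)
  qed
  then show ?thesis by blast
qed

lemma jointly_normal:
  assumes "d \<noteq> 0" "d \<noteq> - q + 1"
  shows "asymptotically_jointly_normal (\<lambda>l. measure_pmf (rs l))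
          (\<lambda>l \<omega>. vector [carries_M q d l \<omega>, carries_N q d l \<omega>] :: real^2)"
proof -
  have "D < 0" "Q + D - 1 > 0" using assms d by linarith+
  obtain K1 K2 where K: "\<And>l. measure_pmf.variance (rs l) (tally 1 0 l) \<le> K1 * real l"
    "\<And>l. measure_pmf.variance (rs l) (tally 0 1 l) \<le> K2 * real l"
    using variance_linear_bound by metis
  show ?thesis
  proof (rule asymptotically_jointly_normalI[where a = "var1 Q D" and b = "var_m1 Q D" and c = "cov Q D" and K = "max K1 K2"])
    show "var1 Q D > 0" "var1 Q D * var_m1 Q D - (cov Q D)\<^sup>2 > 0"
      using var1_pos det_cov_pos \<open>D < 0\<close> \<open>Q + D - 1 > 0\<close> by auto
    show "measure_pmf.variance (rs n) (carries_M q d n) \<le> max K1 K2 * real n" for n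
      using order_trans[OF K(1)[of n] mult_right_mono[of K1 "max K1 K2" "real n"]] by (simp add: tally_M)
    show "measure_pmf.variance (rs n) (carries_N q d n) \<le> max K1 K2 * real n" for n
      using order_trans[OF K(2)[of n] mult_right_mono[of K2 "max K1 K2" "real n"]] by (simp add: tally_N)
    fix s t
    have "tally s t n \<omega> - measure_pmf.expectation (rs n) (tally s t n) =
        s * (carries_M q d n \<omega> - measure_pmf.expectation (rs n) (carries_M q d n))
        + t * (carries_N q d n \<omega> - measure_pmf.expectation (rs n) (carries_N q d n))" for n \<omega>
      unfolding tally_def by (simp add: algebra_simps)
    then show "(\<lambda>n. measure_pmf.expectation (rs n) (\<lambda>\<omega>. cis ((s * (carries_M q d n \<omega> - measure_pmf.expectation (rs n) (carries_M q d n))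
        + t * (carries_N q d n \<omega> - measure_pmf.expectation (rs n) (carries_N q d n))) / sqrt (real n))))
      \<longlonglongrightarrow> exp (- (var1 Q D * s\<^sup>2 + 2 * cov Q D * s * t + var_m1 Q D * t\<^sup>2) / 2)"
      using char_tendsto[of s t] by simp
  qed simp
qed

lemma tally_scale: "tally (t * x) (t * y) l \<omega> = t * tally x y l \<omega>"
  by (simp add: tally_def algebra_simps)

text \<open>The frequency \<open>t\<close> is absorbed into the coefficients: replacing
  \<open>x\<close>, \<open>y\<close> by \<open>t * x\<close>, \<open>t * y\<close> multiplies the
  quadratic form by t^2.\<close>

lemma tally_asymptotically_normal:
  assumes "var1 Q D * x\<^sup>2 + 2 * cov Q D * x * y + var_m1 Q D * y\<^sup>2 > 0" (is "?v > 0")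
  shows "asymptotically_normal (\<lambda>l. measure_pmf (rs l)) (tally x y)"
proof (rule asymptotically_normalI)
  show "sqrt ?v > 0" using assms by simp
  fix t
  have "measure_pmf.expectation (rs n) (tally (t * x) (t * y) n) = t * measure_pmf.expectation (rs n) (tally x y n)" for n
    unfolding tally_scale by simp
  moreover have "- (var1 Q D * (t * x)\<^sup>2 + 2 * cov Q D * (t * x) * (t * y) + var_m1 Q D * (t * y)\<^sup>2) / 2
      = - (sqrt ?v * t)\<^sup>2 / 2"
    using assms by (simp add: power_mult_distrib algebra_simps power2_eq_square)
  ultimately show "(\<lambda>n. measure_pmf.expectation (rs n) (\<lambda>\<omega>. cis (t * ((tally x y n \<omega> - measure_pmf.expectation (rs n) (tally x y n)) / sqrt (real n)))))
      \<longlonglongrightarrow> exp (- (sqrt ?v * t)\<^sup>2 / 2)"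
    using char_tendsto[of "t * x" "t * y"] by (simp add: tally_scale right_diff_distrib)
qed

text \<open>Nonnegative digits and a nonnegative incoming carry keep every sum above
  \<open>d - 1 = - 1\<close>. The bound \<open>j \<le> l\<close> matters since only positions below
  \<open>l\<close> are known to hold digits.\<close>

lemma carry_nonneg:
  assumes "d = 0" "x \<in> expansions q d l" "y \<in> expansions q d l" "j \<le> l"
  shows "carry q d x y j \<noteq> - 1"
  using assms(4)
proof (induction j)
  case (Suc j)
  then have "x j \<ge> 0" "y j \<ge> 0"
    using assms by (auto simp: expansions_def PiE_iff)
  with Suc carry_range[of x y j] show ?case using assms(1) by (auto simp: Let_def)
qed simp

text \<open>Mirror image: digits and carries at most 0 keep every sum below
  \<open>q + d = 1\<close>.\<close>

lemma carry_nonpos: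
  assumes "d = - q + 1" "x \<in> expansions q d l" "y \<in> expansions q d l" "j \<le> l"
  shows "carry q d x y j \<noteq> 1"
  using assms(4)
proof (induction j)
  case (Suc j)
  then have "x j \<le> 0" "y j \<le> 0"
    using assms by (auto simp: expansions_def PiE_iff)
  with Suc carry_range[of x y j] show ?case using assms(1) by (auto simp: Let_def)
qed simp

lemma num_carries_eq_0:
  "(\<And>j. j \<le> l \<Longrightarrow> carry q d x y j \<noteq> t) \<Longrightarrow> num_carries q d t l (x, y) = 0"
  by (simp add: num_carries_eq)

end

theorem theorem1:
  fixes q d :: int and Q D e1 em1 v1 vm1 c :: real
  assumes "q \<ge> 2" and "- q < d" and "d \<le> 0"
  defines "Q \<equiv> real_of_int q" and "D \<equiv> real_of_int d"
  defines "e1 \<equiv> (Q + D - 1)^2 / (2 * (Q - 1)^2)"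
    and "em1 \<equiv> D^2 / (2 * (Q - 1)^2)"
    and "v1 \<equiv> (Q + D - 1)^2 * (Q^4 - 2*Q^3*D - Q^2*D^2 - 4*Q*D^2 - 2*Q^2 - D^2 + 2*D + 1)
                / (4 * (Q - 1)^5 * (Q + 1))"
    and "vm1 \<equiv> D^2 * (2*Q^4 - Q^2*D^2 - 4*Q^3 - 6*Q^2*D - 4*Q*D^2 + 4*Q^2 + 6*Q*D
                        - D^2 - 4*Q + 2)
                / (4 * (Q - 1)^5 * (Q + 1))"
    and "c \<equiv> - (D * (Q + D - 1) * (Q^3*D + Q^2*D^2 - Q^3 + 3*Q^2*D + 4*Q*D^2 + 2*Q^2 - 3*Q*D
                        + D^2 - Q - D))
                / (4 * (Q - 1)^5 * (Q + 1))"
  shows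
    "(\<lambda>l. measure_pmf.expectation (random_summands q d l) (carries_M q d l) - e1 * real l)
       \<in> O(\<lambda>_. 1)
   \<and> (\<lambda>l. measure_pmf.expectation (random_summands q d l) (carries_N q d l) - em1 * real l)
       \<in> O(\<lambda>_. 1)
   \<and> (\<lambda>l. measure_pmf.variance (random_summands q d l) (carries_M q d l) - v1 * real l)
       \<in> O(\<lambda>_. 1)
   \<and> (\<lambda>l. covariance (random_summands q d l) (carries_M q d l) (carries_N q d l) - c * real l)
       \<in> O(\<lambda>_. 1)
   \<and> (\<lambda>l. measure_pmf.variance (random_summands q d l) (carries_N q d l) - vm1 * real l)
       \<in> O(\<lambda>_. 1)
   \<and> (d \<noteq> 0 \<and> d \<noteq> - q + 1 \<longrightarrow>
        asymptotically_jointly_normal (\<lambda>l. measure_pmf (random_summands q d l))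
          (\<lambda>l \<omega>. vector [carries_M q d l \<omega>, carries_N q d l \<omega>] :: real^2))
   \<and> (d = 0 \<longrightarrow>
        asymptotically_normal (\<lambda>l. measure_pmf (random_summands q d l)) (carries_M q d) \<and>
        (\<forall>l. \<forall>x \<in> expansions q d l. \<forall>y \<in> expansions q d l.
           (\<forall>j \<in> {1..l}. carry q d x y j \<noteq> - 1) \<and> carries_N q d l (x, y) = 0))
   \<and> (d = - q + 1 \<longrightarrow>
        asymptotically_normal (\<lambda>l. measure_pmf (random_summands q d l)) (carries_N q d) \<and>
        (\<forall>l. \<forall>x \<in> expansions q d l. \<forall>y \<in> expansions q d l.
           (\<forall>j \<in> {1..l}. carry q d x y j \<noteq> 1) \<and> carries_M q d l (x, y) = 0))"
proof -
  interpret addition q d by unfold_locales (use assms(1-3) in auto)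
  have constants: "e1 = mean1 Q D" "em1 = mean_m1 Q D" "v1 = var1 Q D" "vm1 = var_m1 Q D" "c = cov Q D"
    unfolding e1_def em1_def v1_def vm1_def c_def mean1_def mean_m1_def var1_def var_m1_def cov_def
    by (rule refl)+
  have M: "asymptotically_normal (\<lambda>l. measure_pmf (random_summands q d l)) (carries_M q d)" if "d = 0"
  proof -
    \<comment> \<open>\<open>M\<close> is the combination with coefficients 1 and 0, whose quadratic
      form is \<open>var1\<close>; it stays positive at \<open>d = 0\<close> although the
      determinant vanishes there.\<close>
    have "var1 Q D > 0" using that assms(1) by (intro var1_pos) (auto simp: Q_def D_def)
    then show ?thesis
      using tally_asymptotically_normal[of 1 0] by (simp add: tally_M[abs_def] Q_def D_def)
  qed
  have N: "asymptotically_normal (\<lambda>l. measure_pmf (random_summands q d l)) (carries_N q d)" if "d = - q + 1"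
  proof -
    have "var_m1 Q D > 0" using that assms(1) by (intro var_m1_pos) (auto simp: Q_def D_def)
    then show ?thesis
      using tally_asymptotically_normal[of 0 1] by (simp add: tally_N[abs_def] Q_def D_def)
  qed
  show ?thesis
    unfolding constants Q_def D_def
  proof (intro conjI impI allI ballI mean_bigo variance_bigo covariance_bigo M N num_carries_eq_0)
    fix l j x y
    assume xy: "x \<in> expansions q d l" "y \<in> expansions q d l"
    show "carry q d x y j \<noteq> - 1" if "d = 0" "j \<in> {1..l}" using carry_nonneg[OF that(1) xy] that(2) by simp
    show "carry q d x y j \<noteq> 1" if "d = - q + 1" "j \<in> {1..l}" using carry_nonpos[OF that(1) xy] that(2) by simp
    show "carry q d x y j \<noteq> - 1" if "d = 0" "j \<le> l" using carry_nonneg[OF that(1) xy that(2)] .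
    show "carry q d x y j \<noteq> 1" if "d = - q + 1" "j \<le> l" using carry_nonpos[OF that(1) xy that(2)] .
  qed (simp_all add: jointly_normal)
qed

end
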